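(* Let $n\ge 3$. Let $U$ be an open subset of the space of real symmetric $n\times n$ matrices such that $O^{-1}UO=U$ for every orthogonal matrix $O$, and such that $U\cap\{M+tN \mid 0<t<\infty\}$ is convex for every real symmetric $n\times n$ matrix $M$ and every positive definite real symmetric $n\times n$ matrix $N$. Let $F\in C^1(U)$ be invariant under orthogonal conjugation (that is, $F(O^{-1}MO)=F(M)$ for all $M\in U$ and all orthogonal $O$) and elliptic, i.e. the matrix $\left(F_{ij}(M)\right)$ is positive definite for every $M\in U$, where $F_{ij}(M)=\frac{\partial F}{\partial M_{ij}}(M)$. Let $u\in C^2(\mathbb{R}^n)$ be a positive solution of $$F(A^u)=1\qquad\text{on }\mathbb{R}^n,$$ and assume that $u$ is regular at infinity, i.e. the function $x\mapsto |x|^{2-n}u(x/|x|^2)$ can be extended to a positive $C^2$ function near the origin. Then there exist $\bar x\in\mathbb{R}^n$ and positive constants $a$ and $b$ such that $$u(x)=\left(\frac{a}{1+b^2|x-\bar x|^2}\right)^{\frac{n-2}{2}}\qquad\text{for all }x\in\mathbb{R}^n.$$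
   Context: For a positive $C^2$ function $u$ on an open subset of $\mathbb{R}^n$, $n\ge 3$, $A^u$ denotes the symmetric-matrix-valued function $$A^u:=-\frac{2}{n-2}u^{-\frac{n+2}{n-2}}\nabla^2u+\frac{2n}{(n-2)^2}u^{-\frac{2n}{n-2}}\nabla u\otimes\nabla u-\frac{2}{(n-2)^2}u^{-\frac{2n}{n-2}}|\nabla u|^2 I,$$ where $\nabla u$ and $\nabla^2u$ are the Euclidean gradient and Hessian and $I$ is the $n\times n$ identity matrix. That $u$ solves $F(A^u)=1$ on $\mathbb{R}^n$ means that $A^u(x)\in U$ and $F(A^u(x))=1$ for every $x\in\mathbb{R}^n$. *)

theory Defs
  imports "HOL-Analysis.Analysis"
begin

section \<open>Symmetric matrices and functions on them\<close>

definition sym_matrices :: "(real^'n^'n) set"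
  where "sym_matrices = {M. transpose M = M}"

definition pos_definite :: "real^'n^'n \<Rightarrow> bool"
  where "pos_definite M \<longleftrightarrow> M \<in> sym_matrices \<and> (\<forall>x. x \<noteq> 0 \<longrightarrow> x \<bullet> (M *v x) > 0)"

text \<open>
  \<open>sym_unit i j\<close> is the symmetrised elementary matrix. A symmetric \<open>H\<close> equals the sum of
  \<open>H $ i $ j *\<^sub>R sym_unit i j\<close> over all ordered pairs \<open>(i, j)\<close>.
\<close>

definition sym_unit :: "'n \<Rightarrow> 'n \<Rightarrow> real^'n^'n"
  where "sym_unit i j =
    (\<chi> k l. ((if k = i \<and> l = j then 1 else 0) + (if k = j \<and> l = i then 1 else 0)) / 2)"

text \<open>
  The matrix of the derivatives \<open>F\<^sub>i\<^sub>j\<close> of a function \<open>F\<close> on a relatively open set \<open>U\<close> of symmetric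
  matrices, in the usual convention: it is the symmetric matrix that represents the differential,
  \<open>dF(H) = \<Sum>\<^sub>i\<^sub>j F\<^sub>i\<^sub>j H\<^sub>i\<^sub>j\<close> for symmetric \<open>H\<close> (see \<open>has_derivative_sym_gradient\<close> below). The
  derivative is taken within \<open>U\<close>, so values of \<open>F\<close> outside \<open>U\<close> play no role. A Frechet derivative
  within \<open>U\<close> is determined only on symmetric directions; it is evaluated on no others.
\<close>

definition sym_gradient ::
    "(real^'n^'n) set \<Rightarrow> (real^'n^'n \<Rightarrow> real) \<Rightarrow> real^'n^'n \<Rightarrow> real^'n^'n"
  where "sym_gradient U F M = (\<chi> i j. frechet_derivative F (at M within U) (sym_unit i j))"

definition C1_on_sym :: "(real^'n^'n) set \<Rightarrow> (real^'n^'n \<Rightarrow> real) \<Rightarrow> bool"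
  where "C1_on_sym U F \<longleftrightarrow> F differentiable_on U \<and> continuous_on U (sym_gradient U F)"

lemma sym_unit_commute: "sym_unit i j = sym_unit j i"
  unfolding sym_unit_def by (simp add: vec_eq_iff)

lemma sym_gradient_symmetric: "sym_gradient U F M \<in> sym_matrices"
  unfolding sym_matrices_def sym_gradient_def
  by (simp add: vec_eq_iff transpose_def sym_unit_commute)

lemma sym_matrix_expansion:
  fixes H :: "real^'n^'n"
  assumes "H \<in> sym_matrices"
  shows "H = (\<Sum>i\<in>UNIV. \<Sum>j\<in>UNIV. H $ i $ j *\<^sub>R sym_unit i j)"
proof -
  have sym: "H $ l $ k = H $ k $ l" for k l
    using assms unfolding sym_matrices_def transpose_def by (auto simp: vec_eq_iff)
  have "(\<Sum>i\<in>UNIV. \<Sum>j\<in>UNIV. H $ i $ j *\<^sub>R sym_unit i j) $ k $ l = H $ k $ l" for k l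
  proof -
    have term_split: "(H $ i $ j *\<^sub>R sym_unit i j) $ k $ l =
        (if i = k then if j = l then H $ i $ j / 2 else 0 else 0) +
        (if i = l then if j = k then H $ i $ j / 2 else 0 else 0)" for i j
      unfolding sym_unit_def by auto
    have pull: "(\<Sum>j\<in>UNIV. if i = p then if j = q then c j else 0 else (0::real)) =
        (if i = p then c q else 0)" for i p q :: 'n and c
      by simp
    show ?thesis
      unfolding sum_component term_split sum.distrib pull by (simp add: sym)
  qed
  then show ?thesis by (simp add: vec_eq_iff)
qed

lemma has_derivative_sym_gradient:
  fixes F :: "real^'n^'n \<Rightarrow> real"
  assumes U: "U \<subseteq> sym_matrices" and M: "M \<in> U" and F: "F differentiable (at M within U)"
  shows "(F has_derivative (\<lambda>H. \<Sum>i\<in>UNIV. \<Sum>j\<in>UNIV. sym_gradient U F M $ i $ j * H $ i $ j))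
           (at M within U)"
proof -
  define D where "D = frechet_derivative F (at M within U)"
  define G where "G = (\<lambda>H. \<Sum>i\<in>UNIV. \<Sum>j\<in>UNIV. sym_gradient U F M $ i $ j * H $ i $ j)"
  have D: "(F has_derivative D) (at M within U)"
    using F unfolding D_def frechet_derivative_works .
  then have lin: "linear D" by (rule has_derivative_linear)
  have eq: "D H = G H" if H: "H \<in> sym_matrices" for H
    by (subst sym_matrix_expansion[OF H])
      (simp add: linear_sum[OF lin] linear_cmul[OF lin] G_def sym_gradient_def D_def[symmetric]
        mult.commute)
  have "bounded_linear G"
    unfolding G_def by (intro linear_linear[THEN iffD2] linearI)
      (simp_all add: algebra_simps sum.distrib sum_distrib_left)
  moreover have "D (N - M) = G (N - M)" if "N \<in> U" for N
  proof (rule eq)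
    have "transpose N = N" "transpose M = M"
      using U M that unfolding sym_matrices_def by auto
    then show "N - M \<in> sym_matrices"
      unfolding sym_matrices_def transpose_def by (simp add: vec_eq_iff)
  qed
  ultimately have "(F has_derivative G) (at M within U)"
    using D unfolding has_derivative_within
    by (auto elim!: Lim_transform_eventually simp: eventually_at_filter)
  then show ?thesis unfolding G_def .
qed


section \<open>Gradient, Hessian and the conformal Hessian\<close>

definition gradient :: "(real^'n \<Rightarrow> real) \<Rightarrow> real^'n \<Rightarrow> real^'n"
  where "gradient u x = (\<chi> i. frechet_derivative u (at x) (axis i 1))"

definition hessian :: "(real^'n \<Rightarrow> real) \<Rightarrow> real^'n \<Rightarrow> real^'n^'n"
  where "hessian u x = jacobian (gradient u) (at x)"

text \<open>Only meant for open \<open>S\<close>.\<close>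

definition C2_on :: "(real^'n) set \<Rightarrow> (real^'n \<Rightarrow> real) \<Rightarrow> bool"
  where "C2_on S u \<longleftrightarrow>
    (\<forall>x\<in>S. u differentiable (at x)) \<and>
    (\<forall>x\<in>S. gradient u differentiable (at x)) \<and>
    continuous_on S (hessian u)"

definition outer :: "real^'n \<Rightarrow> real^'n \<Rightarrow> real^'n^'n"
  where "outer v w = (\<chi> i j. v $ i * w $ j)"

definition conformal_hessian :: "(real^'n \<Rightarrow> real) \<Rightarrow> real^'n \<Rightarrow> real^'n^'n"
  where "conformal_hessian u x =
    (let n = real CARD('n) in
      (- (2 / (n - 2)) * u x powr (- ((n + 2) / (n - 2)))) *\<^sub>R hessian u x
      + (2 * n / (n - 2)\<^sup>2 * u x powr (- (2 * n / (n - 2)))) *\<^sub>R outer (gradient u x) (gradient u x)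
      - (2 / (n - 2)\<^sup>2 * u x powr (- (2 * n / (n - 2))) * (norm (gradient u x))\<^sup>2) *\<^sub>R mat 1)"

definition regular_at_infinity :: "(real^'n \<Rightarrow> real) \<Rightarrow> bool"
  where "regular_at_infinity u \<longleftrightarrow>
    (\<exists>S v. open S \<and> 0 \<in> S \<and> C2_on S v \<and> (\<forall>x\<in>S. v x > 0) \<and>
      (\<forall>x\<in>S - {0}. v x = norm x powr (2 - real CARD('n)) * u (x /\<^sub>R (norm x)\<^sup>2)))"

end

theory Submission
  imports Defs
begin

text \<open>
  With \<open>f = u powr (- 2 / (n - 2))\<close> the conformal Hessian becomes \<open>f D\<^sup>2f - |Df|\<^sup>2/2 I\<close>, the Kelvin
  transform becomes \<open>f\<^sub>l(z) = |z|\<^sup>2/l\<^sup>2 f(l\<^sup>2z/|z|\<^sup>2)\<close>, and regularity at infinity gives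
  \<open>f(z) = \<gamma>|z|\<^sup>2 + \<beta>\<cdot>z + o(|z|)\<close>. The method of moving spheres shows \<open>f \<le> f\<^sub>l\<close> on \<open>|z| \<ge> l\<close> for every
  \<open>l\<close> with \<open>\<gamma>l\<^sup>2 \<le> f(0)\<close>: for \<open>\<gamma>l\<^sup>2 < f(0)\<close> there is no contact at infinity, and a contact at finite
  distance is excluded at the contact points furthest from the origin. There the Hessians agree, so
  the equation can be linearised although \<open>U\<close> is not convex, and the Hopf lemma applies. No
  maximum principle is needed at infinity, where the equation may degenerate: for
  \<open>\<gamma>l\<^sup>2 = f(0)\<close> the leading terms of \<open>f\<close> and \<open>f\<^sub>l\<close> agree, and the comparison of the next
  ones gives \<open>Df(0) = \<beta>\<close>. The same about any other centre yields \<open>Df(x) = \<beta> + 2\<gamma>x\<close>, so \<open>f\<close> is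
  a quadratic polynomial.
\<close>

section \<open>Semidefinite matrices\<close>

text \<open>The threshold for \<open>l\<close> comes from the coefficient of \<open>|z|^2\<close> at
  infinity, which is \<open>\<gamma>\<close> for \<open>f\<close> and \<open>f(0) / l^2\<close> for
  \<open>f_l\<close>.

  The obstacle is that two solutions cannot simply be subtracted. The segment between their matrices
  may leave \<open>U\<close>, so the difference need not satisfy a linear elliptic equation, and a
  contact cannot be propagated in the usual way. The segment is known to stay in \<open>U\<close>
  near a point where both matrices coincide. At a contact off the sphere \<open>|z| = l\<close> the
  Hessians are ordered, and strict monotonicity of \<open>F\<close> in positive definite directions,
  which is what convexity along rays provides, forces them to agree. A furthest contact point has
  strict inequality in a ball that touches it from outside; this is the geometry of Hopf's lemma,
  whose conclusion contradicts the equality of the gradients. On the sphere itself, where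
  \<open>f\<close> and \<open>f_l\<close> always agree, the same argument excludes a vanishing
  radial derivative of the difference.\<close>

definition pos_semidefinite :: "real^'n^'n \<Rightarrow> bool"
  where "pos_semidefinite M \<longleftrightarrow> M \<in> sym_matrices \<and> (\<forall>x. 0 \<le> x \<bullet> (M *v x))"

lemma subspace_sym_matrices: "subspace (sym_matrices :: (real^'n^'n) set)"
  unfolding subspace_def sym_matrices_def by (auto simp: transpose_def vec_eq_iff)

lemma sym_matrices_add: "A \<in> sym_matrices \<Longrightarrow> B \<in> sym_matrices \<Longrightarrow> A + B \<in> sym_matrices"
  by (rule subspace_add[OF subspace_sym_matrices])

lemma sym_matrices_diff: "A \<in> sym_matrices \<Longrightarrow> B \<in> sym_matrices \<Longrightarrow> A - B \<in> sym_matrices"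
  by (rule subspace_diff[OF subspace_sym_matrices])

lemma sym_matrices_scaleR: "A \<in> sym_matrices \<Longrightarrow> c *\<^sub>R A \<in> sym_matrices"
  by (rule subspace_scale[OF subspace_sym_matrices])

lemma sym_matrices_mat: "mat c \<in> sym_matrices"
  by (simp add: sym_matrices_def)

lemma outer_self_sym: "outer v v \<in> sym_matrices"
  by (simp add: sym_matrices_def outer_def transpose_def vec_eq_iff)

lemma sym_matrices_inner_commute:
  fixes P :: "real^'n^'n"
  assumes "P \<in> sym_matrices"
  shows "x \<bullet> (P *v y) = y \<bullet> (P *v x)"
proof -
  have "x \<bullet> (P *v y) = (transpose P *v x) \<bullet> y"
    by (simp only: transpose_matrix_vector dot_lmul_matrix)
  with assms show ?thesis by (simp add: sym_matrices_def inner_commute)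
qed

lemma inner_outer: "(A :: real^'n^'n) \<bullet> outer v w = v \<bullet> (A *v w)"
  unfolding inner_vec_def outer_def matrix_vector_mult_def
  by (simp add: sum_distrib_left algebra_simps)

lemma outer_mult_vec: "outer v w *v x = (w \<bullet> x) *\<^sub>R v"
  unfolding inner_vec_def outer_def matrix_vector_mult_def
  by (simp add: vec_eq_iff sum_distrib_left sum_distrib_right algebra_simps)

lemma norm_outer_self: "norm (outer v v) = (norm v)\<^sup>2"
proof -
  have "(norm (outer v v))\<^sup>2 = ((norm v)\<^sup>2)\<^sup>2"
    by (simp add: power2_norm_eq_inner inner_outer outer_mult_vec) (simp add: power2_eq_square)
  then show ?thesis by (rule power2_eq_imp_eq) auto
qed

lemma scaleR_mult_vec: "(c *\<^sub>R A) *v x = c *\<^sub>R (A *v (x :: real^'n))"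
  by (simp add: matrix_vector_mult_def vec_eq_iff sum_distrib_left mult.assoc)

lemma sym_quadratic_form_eq_0:
  fixes P :: "real^'n^'n"
  assumes P: "P \<in> sym_matrices" and 0: "\<And>v. v \<bullet> (P *v v) = 0"
  shows "P = 0"
proof -
  have "x \<bullet> (P *v y) = 0" for x y
    using 0[of "x + y"] 0[of x] 0[of y] sym_matrices_inner_commute[OF P, of x y]
    by (simp add: matrix_vector_right_distrib inner_add_left inner_add_right)
  then have "P *v y = 0 *v y" for y by (metis inner_eq_zero_iff matrix_vector_mult_0)
  then show ?thesis by (simp add: matrix_eq)
qed

lemma pos_semidefinite_nonzeroE:
  fixes P :: "real^'n^'n"
  assumes "pos_semidefinite P" "P \<noteq> 0"
  obtains v where "v \<bullet> (P *v v) > 0"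
proof -
  have "\<not> (\<forall>v. v \<bullet> (P *v v) = 0)"
    using assms sym_quadratic_form_eq_0[of P] unfolding pos_semidefinite_def by blast
  then obtain v where "v \<bullet> (P *v v) \<noteq> 0" by blast
  moreover have "0 \<le> v \<bullet> (P *v v)" using assms by (simp add: pos_semidefinite_def)
  ultimately show ?thesis using that[of v] by simp
qed

text \<open>Completing the square: \<open>x \<bullet> (P' *v x)\<close> is the minimum of the
  quadratic form of \<open>P\<close> on the line \<open>x - t *\<^sub>R v\<close>, hence
  nonnegative. Moreover \<open>v\<close> joins the kernel, so the rank drops. Iterating this takes
  the place of a spectral decomposition.\<close>

lemma pos_semidefinite_peel:
  fixes P :: "real^'n^'n"
  assumes P: "pos_semidefinite P" and p: "v \<bullet> (P *v v) > 0"
  defines "P' \<equiv> P - (1 / (v \<bullet> (P *v v))) *\<^sub>R outer (P *v v) (P *v v)"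
  shows "pos_semidefinite P'"
    and "dim {x. P *v x = 0} < dim {x. P' *v x = 0}"
proof -
  define p where "p = v \<bullet> (P *v v)"
  have p0: "p > 0" using p by (simp add: p_def)
  have sym: "P \<in> sym_matrices" using P by (simp add: pos_semidefinite_def)
  have P'v: "P' *v x = P *v x - ((x \<bullet> (P *v v)) / p) *\<^sub>R (P *v v)" for x
    by (simp add: P'_def matrix_vector_mult_diff_rdistrib scaleR_mult_vec outer_mult_vec p_def
        inner_commute)
  have "0 \<le> x \<bullet> (P' *v x)" for x
  proof -
    define s where "s = x \<bullet> (P *v v)"
    have s': "v \<bullet> (P *v x) = s" using sym_matrices_inner_commute[OF sym] by (simp add: s_def)
    define t where "t = s / p"
    have "0 \<le> (x - t *\<^sub>R v) \<bullet> (P *v (x - t *\<^sub>R v))" using P by (simp add: pos_semidefinite_def)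
    also have "\<dots> = x \<bullet> (P *v x) - 2 * t * s + t * t * p"
      using s' by (simp add: matrix_vector_mult_diff_distrib matrix_vector_mult_scaleR
          inner_diff_left inner_diff_right s_def[symmetric] p_def[symmetric])
        (simp add: algebra_simps)
    also have "\<dots> = x \<bullet> (P *v x) - s * s / p" using p0 by (simp add: t_def field_simps)
    also have "\<dots> = x \<bullet> (P' *v x)" by (simp add: P'v inner_diff_right s_def)
    finally show ?thesis .
  qed
  moreover have "P' \<in> sym_matrices"
    unfolding P'_def by (intro sym_matrices_diff sym_matrices_scaleR outer_self_sym sym)
  ultimately show "pos_semidefinite P'" by (simp add: pos_semidefinite_def)
  have ker: "subspace {x. Q *v x = 0}" for Q :: "real^'n^'n"
    by (auto simp: subspace_def matrix_vector_right_distrib matrix_vector_mult_scaleR)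
  have "{x. P *v x = 0} \<subseteq> {x. P' *v x = 0}"
  proof safe
    fix x assume "P *v x = 0"
    then show "P' *v x = 0" using sym_matrices_inner_commute[OF sym, of x v] by (simp add: P'v)
  qed
  moreover have "P' *v v = 0" using p0 by (simp add: P'v p_def[symmetric])
  moreover have "P *v v \<noteq> 0" using p by auto
  ultimately have "{x. P *v x = 0} \<subset> {x. P' *v x = 0}" by blast
  then show "dim {x. P *v x = 0} < dim {x. P' *v x = 0}"
    by (intro dim_psubset) (simp add: span_eq_iff[THEN iffD2, OF ker])
qed

text \<open>Frobenius products: a positive semidefinite matrix is a sum of matrices \<open>outer w w\<close>.\<close>

lemma inner_pos_semidefinite:
  fixes a P :: "real^'n^'n"
  assumes a: "pos_semidefinite a" and P: "pos_semidefinite P"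
  shows "0 \<le> a \<bullet> P"
  using P
\<comment> \<open>Induction on the rank of \<open>P\<close>, written as the codimension of its
  kernel.\<close>
proof (induction "CARD('n) - dim {x. P *v x = 0}" arbitrary: P rule: less_induct)
  case less
  show ?case
  proof (cases "P = 0")
    case False
    obtain v where v: "v \<bullet> (P *v v) > 0" using pos_semidefinite_nonzeroE[OF less.prems False] .
    define w where "w = P *v v"
    define P' where "P' = P - (1 / (v \<bullet> w)) *\<^sub>R outer w w"
    note peel = pos_semidefinite_peel[OF less.prems v, folded w_def, folded P'_def]
    have "dim {x. P' *v x = 0} \<le> CARD('n)" by (rule dim_subset_UNIV_cart)
    then have "0 \<le> a \<bullet> P'" using peel by (intro less.hyps) auto
    moreover have "0 \<le> a \<bullet> outer w w" using a by (simp add: inner_outer pos_semidefinite_def)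
    moreover have "a \<bullet> P = a \<bullet> P' + (1 / (v \<bullet> w)) * (a \<bullet> outer w w)"
      by (simp add: P'_def inner_diff_right)
    ultimately show ?thesis using v by (simp add: w_def)
  qed simp
qed

lemma pos_definite_imp_semidefinite: "pos_definite a \<Longrightarrow> pos_semidefinite a"
  unfolding pos_definite_def pos_semidefinite_def
  by (metis inner_zero_left order.refl order.strict_implies_order)

text \<open>Peeling off one term suffices: the remainder contributes nonnegatively, and
  \<open>outer w w\<close> with \<open>w \<noteq> 0\<close> contributes
  \<open>w \<bullet> (a *v w) > 0\<close>.\<close>

lemma inner_pos_definite_pos:
  fixes a P :: "real^'n^'n"
  assumes a: "pos_definite a" and P: "pos_semidefinite P" and "P \<noteq> 0"
  shows "0 < a \<bullet> P"
proof -
  obtain v where v: "v \<bullet> (P *v v) > 0" using pos_semidefinite_nonzeroE[OF P \<open>P \<noteq> 0\<close>] .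
  define w where "w = P *v v"
  define P' where "P' = P - (1 / (v \<bullet> (P *v v))) *\<^sub>R outer w w"
  have "0 \<le> a \<bullet> P'"
    using pos_semidefinite_peel(1)[OF P v] a
    by (simp add: P'_def w_def inner_pos_semidefinite pos_definite_imp_semidefinite)
  moreover have "w \<noteq> 0" using v by (auto simp: w_def)
  then have "0 < a \<bullet> outer w w" using a by (simp add: inner_outer pos_definite_def)
  moreover have "a \<bullet> P = a \<bullet> P' + (1 / (v \<bullet> (P *v v))) * (a \<bullet> outer w w)"
    by (simp add: P'_def inner_diff_right)
  ultimately show ?thesis using v by (simp add: add_nonneg_pos)
qed

lemma pos_definite_lower_bound:
  fixes a :: "real^'n^'n"
  assumes "pos_definite a"
  obtains \<mu> where "\<mu> > 0" "\<And>z. \<mu> * (norm z)\<^sup>2 \<le> z \<bullet> (a *v z)"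
proof -
  have "compact (sphere (0::real^'n) 1)" by simp
  moreover have "sphere (0::real^'n) 1 \<noteq> {}" by simp
  moreover have "continuous_on (sphere 0 1) (\<lambda>z. z \<bullet> (a *v z))"
    by (intro continuous_on_inner continuous_on_id matrix_vector_mult_linear_continuous_on)
  ultimately obtain e where e: "norm e = 1" "\<And>z. norm z = 1 \<Longrightarrow> e \<bullet> (a *v e) \<le> z \<bullet> (a *v z)"
    using continuous_attains_inf[of "sphere (0::real^'n) 1" "\<lambda>z. z \<bullet> (a *v z)"] by auto
  have "(e \<bullet> (a *v e)) * (norm z)\<^sup>2 \<le> z \<bullet> (a *v z)" for z
  proof (cases "z = 0")
    case False
    have "e \<bullet> (a *v e) \<le> (z /\<^sub>R norm z) \<bullet> (a *v (z /\<^sub>R norm z))" using False by (intro e) simp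
    also have "\<dots> = (z \<bullet> (a *v z)) / (norm z)\<^sup>2"
      by (simp add: matrix_vector_mult_scaleR power2_eq_square field_simps)
    finally show ?thesis using False by (simp add: field_simps)
  qed simp
  moreover have "e \<noteq> 0" using e(1) by auto
  then have "e \<bullet> (a *v e) > 0" using assms by (simp add: pos_definite_def)
  ultimately show ?thesis using that by blast
qed

lemma pos_definite_mat: "0 < c \<Longrightarrow> pos_definite (c *\<^sub>R mat 1 :: real^'n^'n)"
  by (auto simp: pos_definite_def scaleR_mult_vec intro: sym_matrices_scaleR sym_matrices_mat)

lemma pos_definite_add:
  "pos_semidefinite (A :: real^'n^'n) \<Longrightarrow> pos_definite B \<Longrightarrow> pos_definite (A + B)"
  by (auto simp: pos_definite_def pos_semidefinite_def matrix_vector_mult_add_rdistrib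
      inner_add_right intro: sym_matrices_add add_nonneg_pos)

lemma pos_semidefinite_scaleR:
  "0 \<le> c \<Longrightarrow> pos_semidefinite (A :: real^'n^'n) \<Longrightarrow> pos_semidefinite (c *\<^sub>R A)"
  by (auto simp: pos_semidefinite_def scaleR_mult_vec intro: sym_matrices_scaleR)

section \<open>Elliptic operators\<close>

locale elliptic_equation =
  fixes U :: "(real^'n^'n) set"
    and F :: "real^'n^'n \<Rightarrow> real"
  assumes U_open: "openin (top_of_set sym_matrices) U"
    and U_inv: "\<And>Q :: real^'n^'n. orthogonal_matrix Q \<Longrightarrow>
          (\<lambda>M. matrix_inv Q ** M ** Q) ` U = U"
    and U_convex: "\<And>M N :: real^'n^'n. M \<in> sym_matrices \<Longrightarrow> pos_definite N \<Longrightarrow>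
          convex (U \<inter> {M + t *\<^sub>R N | t. 0 < t})"
    and F_C1: "C1_on_sym U F"
    and F_inv: "\<And>M Q. M \<in> U \<Longrightarrow> orthogonal_matrix Q \<Longrightarrow>
          F (matrix_inv Q ** M ** Q) = F M"
    and F_elliptic: "\<And>M. M \<in> U \<Longrightarrow> pos_definite (sym_gradient U F M)"
begin

lemma U_sym: "M \<in> U \<Longrightarrow> M \<in> sym_matrices"
  using U_open by (auto simp: openin_open)

lemma U_ball:
  assumes "M \<in> U"
  obtains \<delta> where "\<delta> > 0" "\<And>N. N \<in> sym_matrices \<Longrightarrow> dist M N < \<delta> \<Longrightarrow> N \<in> U"
  using U_open assms unfolding openin_euclidean_subtopology_iff by (metis dist_commute)

lemma F_derivative:
  assumes "M \<in> U"
  shows "(F has_derivative (\<lambda>H. sym_gradient U F M \<bullet> H)) (at M within U)"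
proof -
  have "F differentiable (at M within U)"
    using F_C1 assms by (simp add: C1_on_sym_def differentiable_on_def)
  moreover have "U \<subseteq> sym_matrices" using U_sym by blast
  ultimately show ?thesis
    using has_derivative_sym_gradient[of U M F] assms
    by (simp add: inner_vec_def)
qed

lemma F_mean_value:
  assumes seg: "\<And>t. 0 \<le> t \<Longrightarrow> t \<le> 1 \<Longrightarrow> M + t *\<^sub>R N \<in> U"
  obtains t where "0 < t" "t < 1" "F (M + N) - F M = sym_gradient U F (M + t *\<^sub>R N) \<bullet> N"
proof -
  have "((\<lambda>t. F (M + t *\<^sub>R N)) has_derivative (\<lambda>h. sym_gradient U F (M + t *\<^sub>R N) \<bullet> (h *\<^sub>R N)))
      (at t within {0..1})" if t: "0 \<le> t" "t \<le> 1" for t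
  proof -
    have "((\<lambda>t. M + t *\<^sub>R N) has_derivative (\<lambda>h. h *\<^sub>R N)) (at t within {0..1})"
      by (auto intro!: derivative_eq_intros)
    \<comment> \<open>\<open>F\<close> is differentiable within \<open>U\<close> only, so the chain
      rule works with the derivative within the image of the segment.\<close>
    moreover have "(F has_derivative (\<lambda>H. sym_gradient U F (M + t *\<^sub>R N) \<bullet> H))
        (at (M + t *\<^sub>R N) within (\<lambda>t. M + t *\<^sub>R N) ` {0..1})"
      by (rule has_derivative_subset[OF F_derivative]) (use seg t in auto)
    ultimately show ?thesis by (rule has_derivative_in_compose)
  qed
  from mvt_simple[of 0 1, OF _ this] obtain t where "t \<in> {0<..<1}"
    "F (M + 1 *\<^sub>R N) - F (M + 0 *\<^sub>R N) = sym_gradient U F (M + t *\<^sub>R N) \<bullet> ((1 - 0) *\<^sub>R N)"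
    by auto
  then show ?thesis using that by auto
qed

lemma F_strict_mono:
  assumes "M \<in> U" "M + N \<in> U" "pos_definite N"
  shows "F M < F (M + N)"
proof -
  \<comment> \<open>The convexity hypothesis speaks of open rays, which omit their initial point.
    Starting at \<open>M - N\<close> puts \<open>M\<close> and \<open>M + N\<close> at the
    parameters 1 and 2.\<close>
  define L where "L = U \<inter> {(M - N) + t *\<^sub>R N | t. 0 < t}"
  have "N \<in> sym_matrices" using assms by (simp add: pos_definite_def)
  then have "convex L"
    unfolding L_def using assms U_sym by (intro U_convex sym_matrices_diff) auto
  moreover have "M \<in> L" unfolding L_def using assms by (force intro: exI[of _ 1])
  moreover have "M + N \<in> L"
    unfolding L_def using assms by (auto intro!: exI[of _ 2] simp: scaleR_2)
  ultimately have "M + t *\<^sub>R N \<in> U" if "0 \<le> t" "t \<le> 1" for t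
    using convexD_alt[of L M "M + N" t] that by (auto simp: L_def algebra_simps)
  from F_mean_value[OF this] obtain t where t: "0 < t" "t < 1" "M + t *\<^sub>R N \<in> U"
    "F (M + N) - F M = sym_gradient U F (M + t *\<^sub>R N) \<bullet> N"
    by (metis \<open>\<And>t. \<lbrakk>0 \<le> t; t \<le> 1\<rbrakk> \<Longrightarrow> M + t *\<^sub>R N \<in> U\<close> less_imp_le)
  have "N \<noteq> 0"
  proof
    assume "N = 0"
    with assms(3) have "\<forall>x::real^'n. x = 0" by (auto simp: pos_definite_def)
    moreover have "axis undefined 1 \<noteq> (0::real^'n)" by (simp add: axis_eq_0_iff)
    ultimately show False by blast
  qed
  then have "0 < sym_gradient U F (M + t *\<^sub>R N) \<bullet> N"
    using F_elliptic[OF t(3)] assms(3)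
    by (simp add: inner_pos_definite_pos pos_definite_imp_semidefinite)
  with t show ?thesis by linarith
qed

text \<open>
  Convexity of \<open>U\<close> is only known along definite directions, and \<open>N\<close> may be degenerate. Hence the
  comparison first moves a little along \<open>N\<close> and then follows the positive definite direction \<open>(1 - s) *\<^sub>R N + \<eta> *\<^sub>R mat 1\<close>.
\<close>

lemma touching_eq:
  assumes M: "M \<in> U" and MN: "M + N \<in> U" and N: "pos_semidefinite N" and eq: "F (M + N) = F M"
  shows "N = 0"
proof (rule ccontr)
  assume N0: "N \<noteq> 0"
  have Nsym: "N \<in> sym_matrices" using N by (simp add: pos_semidefinite_def)
  obtain \<delta> where \<delta>: "\<delta> > 0" "\<And>A. A \<in> sym_matrices \<Longrightarrow> dist M A < \<delta> \<Longrightarrow> A \<in> U"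
    using U_ball[OF M] by blast
  \<comment> \<open>The second bound keeps the segment from \<open>M\<close> to
    \<open>M + s *\<^sub>R N\<close> inside the ball about \<open>M\<close>; the first makes
    \<open>1 - s\<close> positive for the rest of the path.\<close>
  define s where "s = min (1/2) (\<delta> / (2 * norm N))"
  have s: "0 < s" "s < 1" "s * norm N < \<delta>"
    using \<delta> N0 by (auto simp: s_def min_def field_simps)
  have seg: "M + t *\<^sub>R (s *\<^sub>R N) \<in> U" if "0 \<le> t" "t \<le> 1" for t
  proof (rule \<delta>)
    show "M + t *\<^sub>R (s *\<^sub>R N) \<in> sym_matrices"
      using U_sym[OF M] Nsym by (intro sym_matrices_add sym_matrices_scaleR)
    have "t * (s * norm N) \<le> 1 * (s * norm N)" using that s by (intro mult_right_mono) auto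
    also have "\<dots> < \<delta>" using s by simp
    finally have "\<bar>t\<bar> * \<bar>s\<bar> * norm N < \<delta>" using s that by (simp add: mult.assoc)
    then show "dist M (M + t *\<^sub>R (s *\<^sub>R N)) < \<delta>" by (simp add: dist_norm abs_mult)
  qed
  obtain t where t: "0 < t" "t < 1"
    "F (M + s *\<^sub>R N) - F M = sym_gradient U F (M + t *\<^sub>R (s *\<^sub>R N)) \<bullet> (s *\<^sub>R N)"
    using F_mean_value[OF seg] by blast
  have "0 < sym_gradient U F (M + t *\<^sub>R (s *\<^sub>R N)) \<bullet> N"
    using t N N0 by (intro inner_pos_definite_pos F_elliptic seg) auto
  with t s have less: "F M < F (M + s *\<^sub>R N)" by (simp add: algebra_simps)
  define M1 where "M1 = M + s *\<^sub>R N"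
  have M1: "M1 \<in> U" using seg[of 1] by (simp add: M1_def)
  obtain \<eta>0 where \<eta>0: "\<eta>0 > 0" "\<And>A. A \<in> sym_matrices \<Longrightarrow> dist M1 A < \<eta>0 \<Longrightarrow> A \<in> U"
    using U_ball[OF M1] by blast
  have lim: "((\<lambda>\<eta>. M1 - \<eta> *\<^sub>R mat 1) \<longlongrightarrow> M1) (at_right (0::real))"
    by (auto intro!: tendsto_eq_intros)
  have evU: "eventually (\<lambda>\<eta>. M1 - \<eta> *\<^sub>R mat 1 \<in> U) (at_right (0::real))"
    using tendstoD[OF lim \<eta>0(1)]
  proof eventually_elim
    case (elim \<eta>)
    have "M1 - \<eta> *\<^sub>R mat 1 \<in> sym_matrices"
      using U_sym[OF M1] by (intro sym_matrices_diff sym_matrices_scaleR sym_matrices_mat)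
    then show ?case using \<eta>0(2) elim by (simp add: dist_commute)
  qed
  have "continuous (at M1 within U) F"
    using F_derivative[OF M1] has_derivative_continuous by blast
  then have "((\<lambda>\<eta>. F (M1 - \<eta> *\<^sub>R mat 1)) \<longlongrightarrow> F M1) (at_right (0::real))"
    using evU lim by (rule continuous_within_tendsto_compose)
  moreover have "eventually (\<lambda>\<eta>. F (M1 - \<eta> *\<^sub>R mat 1) \<le> F (M + N)) (at_right (0::real))"
    using evU eventually_at_right_less[of 0]
  proof eventually_elim
    case (elim \<eta>)
    have "pos_definite ((1 - s) *\<^sub>R N + \<eta> *\<^sub>R mat 1)"
      using N s elim by (intro pos_definite_add pos_definite_mat pos_semidefinite_scaleR) auto
    moreover have "M1 - \<eta> *\<^sub>R mat 1 + ((1 - s) *\<^sub>R N + \<eta> *\<^sub>R mat 1) = M + N"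
      by (simp add: M1_def algebra_simps)
    ultimately show ?case
      using F_strict_mono[OF elim(1), of "(1 - s) *\<^sub>R N + \<eta> *\<^sub>R mat 1"] MN by simp
  qed
  \<comment> \<open>The limit retains only a weak inequality, which is enough because the first part
    of the path has gained strictly.\<close>
  ultimately have "F M1 \<le> F (M + N)" by (intro tendsto_upperbound) auto
  with less eq show False by (simp add: M1_def)
qed

text \<open>A ball about \<open>A0\<close> meets the symmetric matrices in a convex set, so segments
  between nearby matrices stay in \<open>U\<close> and the mean value theorem gives a linear
  relation. The coefficient matrix \<open>a\<close> depends on the pair \<open>M1\<close>,
  \<open>M2\<close>, but \<open>\<mu>\<close> and \<open>T\<close> do not; the steepness of the Hopf
  barrier is chosen from them.\<close>

lemma local_ellipticity:
  assumes A0: "A0 \<in> U"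
  obtains \<delta> \<mu> T where "\<delta> > 0" "\<mu> > 0" "T > 0"
    "\<And>M1 M2. \<lbrakk>M1 \<in> U; M2 \<in> U; dist A0 M1 < \<delta>; dist A0 M2 < \<delta>\<rbrakk> \<Longrightarrow>
      \<exists>a. F M2 - F M1 = a \<bullet> (M2 - M1) \<and> pos_definite a \<and> norm a \<le> T \<and>
        (\<forall>z. \<mu> * (norm z)\<^sup>2 \<le> z \<bullet> (a *v z))"
proof -
  define a0 where "a0 = sym_gradient U F A0"
  obtain \<mu> where \<mu>: "\<mu> > 0" "\<And>z. \<mu> * (norm z)\<^sup>2 \<le> z \<bullet> (a0 *v z)"
    using pos_definite_lower_bound F_elliptic[OF A0] unfolding a0_def by blast
  obtain \<delta>1 where \<delta>1: "\<delta>1 > 0" "\<And>A. A \<in> sym_matrices \<Longrightarrow> dist A0 A < \<delta>1 \<Longrightarrow> A \<in> U"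
    using U_ball[OF A0] by blast
  have "continuous_on U (sym_gradient U F)" using F_C1 by (simp add: C1_on_sym_def)
  then obtain \<delta>2 where \<delta>2: "\<delta>2 > 0"
    "\<And>A. A \<in> U \<Longrightarrow> dist A A0 < \<delta>2 \<Longrightarrow> dist (sym_gradient U F A) a0 < \<mu> / 2"
    using A0 \<mu> unfolding continuous_on_iff a0_def by (metis half_gt_zero)
  define \<delta> where "\<delta> = min \<delta>1 \<delta>2"
  show ?thesis
  proof (rule that[of \<delta> "\<mu> / 2" "norm a0 + \<mu>"])
    fix M1 M2 assume M: "M1 \<in> U" "M2 \<in> U" "dist A0 M1 < \<delta>" "dist A0 M2 < \<delta>"
    have seg: "M1 + t *\<^sub>R (M2 - M1) \<in> U \<and> dist (M1 + t *\<^sub>R (M2 - M1)) A0 < \<delta>"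
      if "0 \<le> t" "t \<le> 1" for t
    proof -
      have "(1 - t) *\<^sub>R M1 + t *\<^sub>R M2 \<in> ball A0 \<delta>"
        using M that by (intro convexD_alt convex_ball) auto
      moreover have "(1 - t) *\<^sub>R M1 + t *\<^sub>R M2 = M1 + t *\<^sub>R (M2 - M1)" by (simp add: algebra_simps)
      ultimately have d: "dist A0 (M1 + t *\<^sub>R (M2 - M1)) < \<delta>" by simp
      moreover have "M1 + t *\<^sub>R (M2 - M1) \<in> sym_matrices"
        using M U_sym by (intro sym_matrices_add sym_matrices_scaleR sym_matrices_diff) auto
      ultimately show ?thesis using \<delta>1 by (simp add: \<delta>_def dist_commute)
    qed
    obtain t where t: "0 < t" "t < 1"
      "F (M1 + (M2 - M1)) - F M1 = sym_gradient U F (M1 + t *\<^sub>R (M2 - M1)) \<bullet> (M2 - M1)"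
      using F_mean_value[of M1 "M2 - M1"] seg by blast
    define a where "a = sym_gradient U F (M1 + t *\<^sub>R (M2 - M1))"
    have d: "norm (a - a0) < \<mu> / 2"
      using \<delta>2(2)[of "M1 + t *\<^sub>R (M2 - M1)"] seg[of t] t by (simp add: a_def dist_norm \<delta>_def)
    have "F M2 - F M1 = a \<bullet> (M2 - M1)" using t by (simp add: a_def)
    moreover have "pos_definite a" unfolding a_def using seg[of t] t by (intro F_elliptic) auto
    moreover have "norm a \<le> norm a0 + \<mu>"
      using d norm_triangle_sub[of a a0] \<mu> by linarith
    moreover have "\<mu> / 2 * (norm z)\<^sup>2 \<le> z \<bullet> (a *v z)" for z
    proof -
      \<comment> \<open>Pairing with \<open>outer z z\<close>, whose norm is
        \<open>(norm z)\<^sup>2\<close>, turns closeness of matrices into closeness of quadratic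
        forms, so half of the ellipticity constant of \<open>a0\<close> survives.\<close>
      have "\<bar>(a - a0) \<bullet> outer z z\<bar> \<le> norm (a - a0) * norm (outer z z)"
        by (rule Cauchy_Schwarz_ineq2)
      also have "\<dots> \<le> \<mu> / 2 * (norm z)\<^sup>2"
        unfolding norm_outer_self using d by (intro mult_right_mono) auto
      finally have "\<bar>z \<bullet> (a *v z) - z \<bullet> (a0 *v z)\<bar> \<le> \<mu> / 2 * (norm z)\<^sup>2"
        by (simp add: inner_outer inner_diff_left inner_diff_right matrix_vector_mult_diff_rdistrib)
      with \<mu>(2)[of z] show ?thesis by arith
    qed
    ultimately show "\<exists>a. F M2 - F M1 = a \<bullet> (M2 - M1) \<and> pos_definite a \<and> norm a \<le> norm a0 + \<mu> \<and>
        (\<forall>z. \<mu> / 2 * (norm z)\<^sup>2 \<le> z \<bullet> (a *v z))" by blast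
  qed (use \<mu> \<delta>1 \<delta>2 in \<open>auto simp: \<delta>_def intro: add_nonneg_pos\<close>)
qed

end

section \<open>The Hopf lemma for contact from one side\<close>

text \<open>Carrying gradient and Hessian as arguments lets the explicit formulas for Kelvin
  transforms, powers and barriers serve as derivatives. Symmetry of \<open>H\<close> is read off
  from the equation later.\<close>

definition C2_data ::
    "(real^'n) set \<Rightarrow> (real^'n \<Rightarrow> real) \<Rightarrow> (real^'n \<Rightarrow> real^'n) \<Rightarrow> (real^'n \<Rightarrow> real^'n^'n) \<Rightarrow> bool"
  where "C2_data S f g H \<longleftrightarrow>
    (\<forall>x\<in>S. (f has_derivative (\<lambda>h. g x \<bullet> h)) (at x)) \<and>
    (\<forall>x\<in>S. (g has_derivative (\<lambda>h. H x *v h)) (at x)) \<and>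
    continuous_on S H"

text \<open>The Schouten tensor of the metric \<open>f^-2 |dx|^2\<close>, expressed in the
  orthonormal frame formed by \<open>f\<close> times the coordinate fields.\<close>

definition schouten ::
    "(real^'n \<Rightarrow> real) \<Rightarrow> (real^'n \<Rightarrow> real^'n) \<Rightarrow> (real^'n \<Rightarrow> real^'n^'n) \<Rightarrow> real^'n \<Rightarrow> real^'n^'n"
  where "schouten f g H x = f x *\<^sub>R H x - ((norm (g x))\<^sup>2 / 2) *\<^sub>R mat 1"

lemma C2_dataD:
  assumes "C2_data S f g H" "x \<in> S"
  shows "(f has_derivative (\<lambda>h. g x \<bullet> h)) (at x)" "(g has_derivative (\<lambda>h. H x *v h)) (at x)"
  using assms by (auto simp: C2_data_def)

lemma C2_data_isCont:
  assumes "C2_data S f g H" "open S" "x \<in> S"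
  shows "isCont f x" "isCont g x" "isCont H x"
proof -
  show "isCont f x" "isCont g x"
    using C2_dataD[OF assms(1,3)] has_derivative_continuous by blast+
  show "isCont H x"
    using assms continuous_on_eq_continuous_at by (auto simp: C2_data_def)
qed

lemma C2_data_subset: "C2_data S f g H \<Longrightarrow> T \<subseteq> S \<Longrightarrow> C2_data T f g H"
  by (auto simp: C2_data_def intro: continuous_on_subset)

lemma C2_data_diff:
  assumes "C2_data S f1 g1 H1" "C2_data S f2 g2 H2"
  shows "C2_data S (\<lambda>x. f1 x - f2 x) (\<lambda>x. g1 x - g2 x) (\<lambda>x. H1 x - H2 x)"
  using assms unfolding C2_data_def inner_diff_left matrix_vector_mult_diff_rdistrib
  by (auto intro: has_derivative_diff continuous_on_diff)

lemma C2_data_scaleR: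
  assumes "C2_data S f g H"
  shows "C2_data S (\<lambda>x. c * f x) (\<lambda>x. c *\<^sub>R g x) (\<lambda>x. c *\<^sub>R H x)"
  using assms unfolding C2_data_def inner_scaleR_left scaleR_mult_vec
  by (auto intro: has_derivative_mult_right has_derivative_scaleR_right continuous_on_scaleR
      continuous_on_const)

text \<open>The source of the symmetry of second derivatives: members of \<open>U\<close> are
  symmetric, and \<open>H x\<close> arises from such a matrix by adding a multiple of the identity
  and dividing by \<open>f x\<close>.\<close>

lemma schouten_sym_imp_hessian_sym:
  assumes "schouten f g H x \<in> sym_matrices" "f x \<noteq> 0"
  shows "H x \<in> sym_matrices"
proof -
  have "H x = (1 / f x) *\<^sub>R (schouten f g H x + ((norm (g x))\<^sup>2 / 2) *\<^sub>R mat 1)"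
    using assms(2) by (simp add: schouten_def)
  then show ?thesis
    using assms(1) by (metis sym_matrices_add sym_matrices_scaleR sym_matrices_mat)
qed

section \<open>One-sided second order conditions\<close>

lemma second_derivative_nonneg:
  fixes f f' :: "real \<Rightarrow> real"
  assumes d: "0 < d"
    and f: "\<And>t. 0 \<le> t \<Longrightarrow> t < d \<Longrightarrow> (f has_real_derivative f' t) (at t)"
    and f': "(f' has_real_derivative c) (at 0)" "f' 0 = 0"
    and min: "\<And>t. 0 < t \<Longrightarrow> t < d \<Longrightarrow> f 0 \<le> f t"
  shows "0 \<le> c"
proof (rule ccontr)
  assume "\<not> 0 \<le> c"
  then obtain e where e: "e > 0" "\<And>h. 0 < h \<Longrightarrow> h < e \<Longrightarrow> f' h < 0"
    using DERIV_neg_dec_right[OF f'(1)] f'(2) by auto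
  define t where "t = min d e / 2"
  have t: "0 < t" "t < d" "t < e" using d e by (auto simp: t_def)
  obtain \<xi> where \<xi>: "0 < \<xi>" "\<xi> < t" "f t - f 0 = (t - 0) * f' \<xi>"
    using MVT2[of 0 t f f'] f t by (metis le_less_trans)
  then have "f t - f 0 < 0" using e(2)[of \<xi>] t by (simp add: mult_pos_neg)
  with min[OF t(1,2)] show False by simp
qed

text \<open>Minimality is asked along a single ray, because at points of the sphere of inversion the
  comparison has a definite sign on each side only. The vanishing of the derivative along
  \<open>v\<close> is therefore a hypothesis and not a consequence.\<close>

lemma C2_data_second_order_condition:
  assumes C2: "C2_data S f g H" and S: "open S" "x \<in> S" and v: "g x \<bullet> v = 0"
    and min: "eventually (\<lambda>t. f x \<le> f (x + t *\<^sub>R v)) (at_right 0)"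
  shows "0 \<le> v \<bullet> (H x *v v)"
proof -
  obtain d1 where d1: "d1 > 0" "\<And>t. 0 < t \<Longrightarrow> t < d1 \<Longrightarrow> f x \<le> f (x + t *\<^sub>R v)"
    using min unfolding eventually_at_right_field by auto
  have "((\<lambda>t. x + t *\<^sub>R v) \<longlongrightarrow> x) (at_right (0::real))" by (auto intro!: tendsto_eq_intros)
  from topological_tendstoD[OF this S]
  obtain d2 where d2: "d2 > 0" "\<And>t. 0 < t \<Longrightarrow> t < d2 \<Longrightarrow> x + t *\<^sub>R v \<in> S"
    unfolding eventually_at_right_field by auto
  have line: "((\<lambda>t. x + t *\<^sub>R v) has_derivative (\<lambda>h. h *\<^sub>R v)) (at t)" for t
    by (auto intro!: derivative_eq_intros)
  show ?thesis
  proof (rule second_derivative_nonneg[of "min d1 d2" "\<lambda>t. f (x + t *\<^sub>R v)" "\<lambda>t. g (x + t *\<^sub>R v) \<bullet> v"])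
    show "((\<lambda>t. f (x + t *\<^sub>R v)) has_real_derivative g (x + t *\<^sub>R v) \<bullet> v) (at t)"
      if "0 \<le> t" "t < min d1 d2" for t
    proof -
      have "x + t *\<^sub>R v \<in> S" using d2 S that by (cases "t = 0") auto
      from has_derivative_compose[OF line C2_dataD(1)[OF C2 this]]
      show ?thesis by (simp add: has_field_derivative_def mult_commute_abs)
    qed
    have "((\<lambda>t. g (x + t *\<^sub>R v)) has_derivative (\<lambda>h. H x *v (h *\<^sub>R v))) (at 0)"
      using has_derivative_compose[OF line[of 0], of g "\<lambda>h. H x *v h"] C2_dataD(2)[OF C2 S(2)]
      by simp
    then have "((\<lambda>t. g (x + t *\<^sub>R v) \<bullet> v) has_derivative (\<lambda>h. (H x *v (h *\<^sub>R v)) \<bullet> v)) (at 0)"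
      by (rule has_derivative_inner_left)
    then show "((\<lambda>t. g (x + t *\<^sub>R v) \<bullet> v) has_real_derivative v \<bullet> (H x *v v)) (at 0)"
      by (simp add: has_field_derivative_def matrix_vector_mult_scaleR mult_commute_abs
          inner_commute)
  qed (use d1 d2 v in auto)
qed

text \<open>The exponential barrier of Hopf. Apart from the exponential factor, its Hessian is of
  order \<open>k\<^sup>2\<close> in the direction \<open>x - c\<close> and otherwise of order
  \<open>k\<close>, so away from \<open>c\<close> a large \<open>k\<close> makes it a strict
  subsolution.\<close>

lemma C2_data_barrier:
  fixes c :: "real^'n"
  shows "C2_data UNIV (\<lambda>x. exp (- k * (norm (x - c))\<^sup>2) - d)
    (\<lambda>x. (- 2 * k * exp (- k * (norm (x - c))\<^sup>2)) *\<^sub>R (x - c))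
    (\<lambda>x. exp (- k * (norm (x - c))\<^sup>2) *\<^sub>R ((4 * k\<^sup>2) *\<^sub>R outer (x - c) (x - c) - (2 * k) *\<^sub>R mat 1))"
proof -
  have E: "((\<lambda>x. exp (- k * (norm (x - c))\<^sup>2)) has_derivative
      (\<lambda>h. ((- 2 * k * exp (- k * (norm (x - c))\<^sup>2)) *\<^sub>R (x - c)) \<bullet> h)) (at x)" for x
    unfolding power2_norm_eq_inner
    by (auto intro!: derivative_eq_intros simp: inner_commute algebra_simps)
  have alg: "(- 2 * k * e) *\<^sub>R h + (- 2 * k * (((- 2 * k * e) *\<^sub>R z) \<bullet> h)) *\<^sub>R z =
      (e *\<^sub>R ((4 * k\<^sup>2) *\<^sub>R outer z z - (2 * k) *\<^sub>R mat 1)) *v h" for z h :: "real^'n" and e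
    by (simp add: scaleR_mult_vec outer_mult_vec matrix_vector_mult_diff_rdistrib algebra_simps
        power2_eq_square)
  have "((\<lambda>x. exp (- k * (norm (x - c))\<^sup>2) - d) has_derivative
      (\<lambda>h. ((- 2 * k * exp (- k * (norm (x - c))\<^sup>2)) *\<^sub>R (x - c)) \<bullet> h)) (at x)" for x
    using has_derivative_diff[OF E has_derivative_const] by simp
  moreover have "((\<lambda>x. (- 2 * k * exp (- k * (norm (x - c))\<^sup>2)) *\<^sub>R (x - c)) has_derivative
      (\<lambda>h. (exp (- k * (norm (x - c))\<^sup>2) *\<^sub>R
        ((4 * k\<^sup>2) *\<^sub>R outer (x - c) (x - c) - (2 * k) *\<^sub>R mat 1)) *v h)) (at x)" for x
    using has_derivative_scaleR[OF has_derivative_mult_right[OF E, of "- 2 * k"]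
        has_derivative_diff[OF has_derivative_ident has_derivative_const[of c]]]
    by (rule has_derivative_eq_rhs) (simp only: alg diff_zero)
  moreover have "continuous_on UNIV (\<lambda>x. exp (- k * (norm (x - c))\<^sup>2) *\<^sub>R
      ((4 * k\<^sup>2) *\<^sub>R outer (x - c) (x - c) - (2 * k) *\<^sub>R mat 1))"
    unfolding outer_def by (intro continuous_intros)
  ultimately show ?thesis by (simp add: C2_data_def)
qed

text \<open>The computation at a negative interior minimum of the difference minus the barrier.
  There \<open>p\<close> and \<open>p - w\<close> are the two values, the gradients differ by that
  of the barrier, and the Hessians differ by at least its Hessian. In the linearised equation the
  term \<open>k\<^sup>2 * m * \<mu>\<close> then beats all others, which are of order at most
  \<open>k\<close>. The requirement on \<open>k\<close> does not involve \<open>\<epsilon>\<close>,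
  which is chosen after \<open>k\<close>.\<close>

lemma barrier_inequality:
  fixes a H1 H2 :: "real^'n^'n" and G1 G2 z :: "real^'n"
  assumes lin: "a \<bullet> ((p *\<^sub>R H2 - ((norm G2)\<^sup>2 / 2) *\<^sub>R mat 1)
                   - ((p - w) *\<^sub>R H1 - ((norm G1)\<^sup>2 / 2) *\<^sub>R mat 1)) = 0"
    and G: "G2 - G1 = \<epsilon> *\<^sub>R ((- 2 * k * E) *\<^sub>R z)"
    and psd: "pos_semidefinite
      (H2 - H1 - \<epsilon> *\<^sub>R (E *\<^sub>R ((4 * k\<^sup>2) *\<^sub>R outer z z - (2 * k) *\<^sub>R mat 1)))"
    and a: "pos_semidefinite a" "norm a \<le> T" "\<mu> * (norm z)\<^sup>2 \<le> z \<bullet> (a *v z)" "0 < \<mu>"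
    and p: "0 < m" "m \<le> p" "p \<le> M" and w: "0 \<le> w" "w \<le> \<epsilon> * E"
    and K: "norm H1 \<le> K" "norm (G1 + G2) \<le> K" and z: "1/2 \<le> norm z" "norm z \<le> 1"
    and pos: "0 < \<epsilon>" "0 < E" "1 \<le> k"
    and T1: "T1 = T * norm (mat 1 :: real^'n^'n)"
    and k: "2 * M * T1 + T * K + K * T1 < k * m * \<mu>"
  shows False
proof -
  define tr where "tr = a \<bullet> mat 1"
  have T0: "0 \<le> T" using a(2) norm_ge_zero[of a] by linarith
  have K0: "0 \<le> K" using K(1) norm_ge_zero[of H1] by linarith
  have "\<bar>tr\<bar> \<le> norm a * norm (mat 1 :: real^'n^'n)" unfolding tr_def by (rule Cauchy_Schwarz_ineq2)
  also have "\<dots> \<le> T1" unfolding T1 by (intro mult_right_mono a) auto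
  finally have tr: "\<bar>tr\<bar> \<le> T1" .
  then have T10: "0 \<le> T1" by linarith
  have sq: "(norm G2)\<^sup>2 - (norm G1)\<^sup>2 = (G2 - G1) \<bullet> (G1 + G2)"
    by (simp add: power2_norm_eq_inner inner_diff_left inner_diff_right inner_add_right inner_commute)
  have "0 = p * (a \<bullet> (H2 - H1)) + w * (a \<bullet> H1) - ((norm G2)\<^sup>2 - (norm G1)\<^sup>2) / 2 * tr"
    using lin by (simp add: tr_def inner_diff_right algebra_simps diff_divide_distrib)
  also have "(norm G2)\<^sup>2 - (norm G1)\<^sup>2 = \<epsilon> * (- 2 * k * E) * (z \<bullet> (G1 + G2))"
    unfolding sq G by simp
  finally have eq: "0 = p * (a \<bullet> (H2 - H1)) + w * (a \<bullet> H1) + \<epsilon> * E * (k * ((z \<bullet> (G1 + G2)) * tr))"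
    by (simp add: mult_ac)
  have "0 \<le> a \<bullet> (H2 - H1 - \<epsilon> *\<^sub>R (E *\<^sub>R ((4 * k\<^sup>2) *\<^sub>R outer z z - (2 * k) *\<^sub>R mat 1)))"
    by (rule inner_pos_semidefinite[OF a(1) psd])
  then have "\<epsilon> * E * (4 * k\<^sup>2 * (z \<bullet> (a *v z)) - 2 * k * tr) \<le> a \<bullet> (H2 - H1)"
    by (simp add: inner_diff_right inner_outer tr_def[symmetric] mult.assoc)
  then have "p * (\<epsilon> * E * (4 * k\<^sup>2 * (z \<bullet> (a *v z)) - 2 * k * tr)) \<le> p * (a \<bullet> (H2 - H1))"
    using p by (intro mult_left_mono) auto
  moreover have "\<epsilon> * E * (k\<^sup>2 * m * \<mu> - 2 * k * (M * T1))
      \<le> p * (\<epsilon> * E * (4 * k\<^sup>2 * (z \<bullet> (a *v z)) - 2 * k * tr))"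
  proof -
    \<comment> \<open>The lower bound 1/2 for the distance to the centre is absorbed exactly by the
      factor 4 in the Hessian of the barrier.\<close>
    have "(1/2)\<^sup>2 \<le> (norm z)\<^sup>2" using z by (intro power_mono) auto
    then have "\<mu> * (1/2)\<^sup>2 \<le> \<mu> * (norm z)\<^sup>2" using a(4) by (intro mult_left_mono) auto
    with a(3) have "\<mu> \<le> 4 * (z \<bullet> (a *v z))" by (simp add: power2_eq_square)
    then have "m * \<mu> \<le> p * (4 * (z \<bullet> (a *v z)))" using p a(4) by (intro mult_mono) auto
    then have "k\<^sup>2 * (m * \<mu>) \<le> k\<^sup>2 * (p * (4 * (z \<bullet> (a *v z))))" by (intro mult_left_mono) auto
    moreover have "p * tr \<le> p * T1" using p tr by (intro mult_left_mono) auto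
    then have "p * tr \<le> M * T1" using mult_right_mono[OF p(3) T10] by linarith
    then have "(2 * k) * (p * tr) \<le> (2 * k) * (M * T1)" using pos by (intro mult_left_mono) auto
    ultimately have "k\<^sup>2 * m * \<mu> - 2 * k * (M * T1) \<le> p * (4 * k\<^sup>2 * (z \<bullet> (a *v z)) - 2 * k * tr)"
      by (simp add: algebra_simps)
    then have "\<epsilon> * E * (k\<^sup>2 * m * \<mu> - 2 * k * (M * T1)) \<le>
        \<epsilon> * E * (p * (4 * k\<^sup>2 * (z \<bullet> (a *v z)) - 2 * k * tr))"
      using pos by (intro mult_left_mono) auto
    then show ?thesis by (simp only: mult.left_commute)
  qed
  \<comment> \<open>The bound \<open>w \<le> \<epsilon> * E\<close> gives the zero order term the
    same factor \<open>\<epsilon> * E\<close> as the others, so that this factor can be cancelled at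
    the end.\<close>
  moreover have "- (\<epsilon> * E * (T * K)) \<le> w * (a \<bullet> H1)"
  proof -
    have "\<bar>a \<bullet> H1\<bar> \<le> norm a * norm H1" by (rule Cauchy_Schwarz_ineq2)
    also have "\<dots> \<le> T * K" using T0 by (intro mult_mono a K) auto
    finally have "w * \<bar>a \<bullet> H1\<bar> \<le> \<epsilon> * E * (T * K)" using w T0 K0 pos by (intro mult_mono) auto
    moreover have "\<bar>w * (a \<bullet> H1)\<bar> = w * \<bar>a \<bullet> H1\<bar>" using w by (simp add: abs_mult)
    ultimately show ?thesis by linarith
  qed
  moreover have "\<epsilon> * E * (k * - (K * T1)) \<le> \<epsilon> * E * (k * ((z \<bullet> (G1 + G2)) * tr))"
  proof -
    have "\<bar>z \<bullet> (G1 + G2)\<bar> \<le> norm z * norm (G1 + G2)" by (rule Cauchy_Schwarz_ineq2)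
    also have "\<dots> \<le> 1 * K" using z K by (intro mult_mono) auto
    finally have "\<bar>z \<bullet> (G1 + G2)\<bar> * \<bar>tr\<bar> \<le> K * T1" using tr K0 by (intro mult_mono) auto
    then have "- (K * T1) \<le> (z \<bullet> (G1 + G2)) * tr" by (simp add: abs_mult[symmetric] abs_le_iff)
    then show ?thesis using pos by (intro mult_left_mono) auto
  qed
  ultimately have "\<epsilon> * E * (k\<^sup>2 * m * \<mu> - 2 * k * (M * T1) - T * K - k * (K * T1)) \<le> 0"
    using eq by (simp add: algebra_simps)
  moreover have "0 < k\<^sup>2 * m * \<mu> - 2 * k * (M * T1) - T * K - k * (K * T1)"
  proof -
    have "k * (2 * M * T1 + T * K + K * T1) < k * (k * m * \<mu>)"
      using k pos by (intro mult_strict_left_mono) auto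
    \<comment> \<open>The zero order bound lacks a factor \<open>k\<close>; \<open>1 \<le> k\<close>
      supplies it.\<close>
    moreover have "1 * (T * K) \<le> k * (T * K)" using pos T0 K0 by (intro mult_right_mono) auto
    ultimately show ?thesis by (simp add: algebra_simps power2_eq_square)
  qed
  ultimately show False using pos by (simp add: mult_le_0_iff)
qed

text \<open>Two balls tangent from outside meet in one point only. Adding \<open>R\<close> times the
  first squared inequality to the second leaves \<open>R + 1\<close> times the squared distance from
  that point.\<close>

lemma exterior_tangent_ball:
  fixes e x :: "'a::real_inner"
  assumes e: "norm e = 1" and R: "0 < R" and x: "norm (x - (R + 1) *\<^sub>R e) \<le> 1" "norm x \<le> R"
  shows "x = R *\<^sub>R e"
proof -
  have ee: "e \<bullet> e = 1" using e by (simp add: dot_square_norm)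
  have expand: "(norm (x - r *\<^sub>R e))\<^sup>2 = (norm x)\<^sup>2 - 2 * r * (x \<bullet> e) + r\<^sup>2" for r
    unfolding power2_norm_eq_inner
    by (simp add: inner_diff_left inner_diff_right ee inner_commute power2_eq_square)
  have "(norm (x - (R + 1) *\<^sub>R e))\<^sup>2 \<le> 1\<^sup>2" using x by (intro power_mono) auto
  then have 1: "(norm x)\<^sup>2 - 2 * (R + 1) * (x \<bullet> e) + (R + 1)\<^sup>2 \<le> 1"
    unfolding expand by simp
  have 2: "(norm x)\<^sup>2 \<le> R\<^sup>2" using x by (intro power_mono) auto
  have "(R + 1) * (norm (x - R *\<^sub>R e))\<^sup>2 = R * ((norm x)\<^sup>2 - 2 * (R + 1) * (x \<bullet> e) + (R + 1)\<^sup>2 - 1)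
      + ((norm x)\<^sup>2 - R\<^sup>2)"
    unfolding expand by (simp add: algebra_simps power2_eq_square)
  also have "\<dots> \<le> 0" using 1 2 R by (simp add: mult_le_0_iff add_nonpos_nonpos)
  finally have "(norm (x - R *\<^sub>R e))\<^sup>2 \<le> 0" using R by (simp add: mult_le_0_iff)
  then show ?thesis by simp
qed

context elliptic_equation
begin

text \<open>The contact conditions put both matrices at the same \<open>A0\<close>, so the equation
  can be linearised near \<open>z1\<close>. Hopf's argument in a ball touching at \<open>z1\<close>
  from outside would force \<open>f2 - f1\<close> to increase there at a positive rate, against the
  equality of the gradients.\<close>

lemma hopf_contact:
  assumes S: "open S" "z1 \<in> S" and z1: "z1 \<noteq> 0"
    and D1: "C2_data S f1 g1 H1" and D2: "C2_data S f2 g2 H2"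
    and pos: "\<And>x. x \<in> S \<Longrightarrow> 0 < f1 x" "\<And>x. x \<in> S \<Longrightarrow> 0 < f2 x"
    and eq1: "\<And>x. x \<in> S \<Longrightarrow> schouten f1 g1 H1 x \<in> U \<and> F (schouten f1 g1 H1 x) = 1"
    and eq2: "\<And>x. x \<in> S \<Longrightarrow> schouten f2 g2 H2 x \<in> U \<and> F (schouten f2 g2 H2 x) = 1"
    and contact: "f1 z1 = f2 z1" "g1 z1 = g2 z1" "H1 z1 = H2 z1"
    and less: "\<And>x. x \<in> S \<Longrightarrow> norm z1 < norm x \<Longrightarrow> f1 x < f2 x"
  shows False
proof -
  define A0 where "A0 = schouten f1 g1 H1 z1"
  have A0: "A0 = schouten f2 g2 H2 z1" using contact by (simp add: A0_def schouten_def)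
  have "A0 \<in> U" using eq1[OF S(2)] by (simp add: A0_def)
  then obtain \<delta> \<mu> T where T: "\<delta> > 0" "\<mu> > 0" "T > 0"
    and ell: "\<And>M1 M2. \<lbrakk>M1 \<in> U; M2 \<in> U; dist A0 M1 < \<delta>; dist A0 M2 < \<delta>\<rbrakk> \<Longrightarrow>
      \<exists>a. F M2 - F M1 = a \<bullet> (M2 - M1) \<and> pos_definite a \<and> norm a \<le> T \<and>
        (\<forall>z. \<mu> * (norm z)\<^sup>2 \<le> z \<bullet> (a *v z))"
    using local_ellipticity by blast
  \<comment> \<open>Bounds for the coefficients at \<open>z1\<close>, with slack so that they
    persist in a neighbourhood.\<close>
  define m where "m = f2 z1 / 2"
  define M where "M = f2 z1 + 1"
  define K where "K = norm (H1 z1) + norm (g1 z1 + g2 z1) + 1"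
  have mMK: "0 < m" "0 < M" "0 < K"
    using pos(2)[OF S(2)] by (auto simp: m_def M_def K_def add_nonneg_pos)
  note cont = C2_data_isCont[OF D1 S] C2_data_isCont[OF D2 S]
  have sch: "isCont (schouten f1 g1 H1) z1" "isCont (schouten f2 g2 H2) z1"
    unfolding schouten_def using cont by (auto intro!: continuous_intros)
  have "eventually (\<lambda>x. x \<in> S \<and> dist A0 (schouten f1 g1 H1 x) < \<delta> \<and> dist A0 (schouten f2 g2 H2 x) < \<delta> \<and>
      norm (H1 x) < K \<and> norm (g1 x + g2 x) < K \<and> m < f2 x \<and> f2 x < M) (nhds z1)"
  proof (intro eventually_conj)
    show "eventually (\<lambda>x. x \<in> S) (nhds z1)" using S by (simp add: eventually_nhds_in_open)
    have lim: "filterlim f (nhds (f z1)) (nhds z1)" if "isCont f z1" for f :: "real^'n \<Rightarrow> 'b::topological_space"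
      using that by (simp add: isCont_def tendsto_at_iff_tendsto_nhds)
    show "eventually (\<lambda>x. dist A0 (schouten f1 g1 H1 x) < \<delta>) (nhds z1)"
      using tendstoD[OF lim[OF sch(1)] T(1)] by (simp add: A0_def dist_commute)
    show "eventually (\<lambda>x. dist A0 (schouten f2 g2 H2 x) < \<delta>) (nhds z1)"
      using tendstoD[OF lim[OF sch(2)] T(1)] by (simp add: A0 dist_commute)
    show "eventually (\<lambda>x. norm (H1 x) < K) (nhds z1)"
      using cont by (intro order_tendstoD(2)[OF tendsto_norm[OF lim]]) (auto simp: K_def add_nonneg_pos)
    show "eventually (\<lambda>x. norm (g1 x + g2 x) < K) (nhds z1)"
      using cont by (intro order_tendstoD(2)[OF tendsto_norm[OF tendsto_add[OF lim lim]]])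
        (auto simp: K_def add_nonneg_pos)
    show "eventually (\<lambda>x. m < f2 x) (nhds z1)" "eventually (\<lambda>x. f2 x < M) (nhds z1)"
      using cont pos(2)[OF S(2)]
      by (auto simp: m_def M_def intro!: order_tendstoD[OF lim])
  qed
  then obtain \<rho>0 where \<rho>0: "\<rho>0 > 0" and near: "\<And>x. dist x z1 < \<rho>0 \<Longrightarrow>
      x \<in> S \<and> dist A0 (schouten f1 g1 H1 x) < \<delta> \<and> dist A0 (schouten f2 g2 H2 x) < \<delta> \<and>
      norm (H1 x) < K \<and> norm (g1 x + g2 x) < K \<and> m < f2 x \<and> f2 x < M"
    unfolding eventually_nhds_metric by blast
  \<comment> \<open>The centre \<open>c\<close> chosen below has distance 1 from \<open>z1\<close>;
    radius at most 1/2 keeps the points near \<open>z1\<close> at distance at least 1/2 from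
    \<open>c\<close>, as \<open>barrier_inequality\<close> demands.\<close>
  define \<rho> where "\<rho> = min (1/2) (\<rho>0 / 2)"
  have \<rho>: "0 < \<rho>" "\<rho> \<le> 1/2" "\<rho> < \<rho>0" using \<rho>0 by (auto simp: \<rho>_def)
  define T1 where "T1 = T * norm (mat 1 :: real^'n^'n)"
  define B where "B = 2 * M * T1 + T * K + K * T1"
  \<comment> \<open>\<open>k * m * \<mu>\<close> becomes \<open>m * \<mu> + B\<close>, which exceeds
    \<open>B\<close>, and the summand 1 also ensures \<open>1 \<le> k\<close>.\<close>
  define k where "k = 1 + B / (m * \<mu>)"
  have "0 \<le> T1" using T by (simp add: T1_def)
  then have B0: "0 \<le> B" using mMK T by (simp add: B_def)
  have k: "1 \<le> k" "B < k * m * \<mu>"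
    using B0 mMK T by (simp_all add: k_def distrib_right)
  define R where "R = norm z1"
  define e where "e = z1 /\<^sub>R R"
  have R: "0 < R" and e: "norm e = 1" and z1e: "z1 = R *\<^sub>R e" using z1 by (auto simp: R_def e_def)
  define c where "c = (R + 1) *\<^sub>R e"
  have z1c: "z1 - c = - e" by (simp add: z1e c_def algebra_simps)
  define D where "D = cball c 1 \<inter> cball z1 \<rho>"
  define w where "w = (\<lambda>x. f2 x - f1 x)"
  have DS: "x \<in> S" if "x \<in> D" for x using near[of x] that \<rho> by (auto simp: D_def dist_commute)
  have w_pos: "0 < w x" if "x \<in> D" "x \<noteq> z1" for x
  proof -
    have "norm (x - (R + 1) *\<^sub>R e) \<le> 1" using that by (simp add: D_def c_def dist_norm norm_minus_commute)
    then have "R < norm x" using exterior_tangent_ball[OF e R] that z1e by (metis not_le)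
    then show ?thesis using less[OF DS[OF that(1)]] by (simp add: w_def R_def)
  qed
  have w0: "w z1 = 0" using contact by (simp add: w_def)
  have w_nonneg: "0 \<le> w x" if "x \<in> D" for x using w_pos[OF that] w0 by fastforce
  have Dw: "C2_data S w (\<lambda>x. g2 x - g1 x) (\<lambda>x. H2 x - H1 x)"
    unfolding w_def by (rule C2_data_diff[OF D2 D1])
  define E where "E = (\<lambda>x. exp (- k * (norm (x - c))\<^sup>2))"
  \<comment> \<open>Subtracting \<open>exp (- k)\<close> makes the barrier vanish on the unit sphere
    about \<open>c\<close>, in particular at \<open>z1\<close>.\<close>
  define hb where "hb = (\<lambda>x. E x - exp (- k))"
  have E: "0 < E x" "E x \<le> 1" for x using k by (auto simp: E_def)
  have hb_le: "hb x \<le> E x" for x by (simp add: hb_def)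
  have cD: "continuous_on D w"
    using C2_data_isCont(1)[OF Dw S(1)] DS by (intro continuous_at_imp_continuous_on) auto
  \<comment> \<open>This part of the boundary of \<open>D\<close> is compact and avoids
    \<open>z1\<close>, so \<open>w\<close> has a positive minimum on it unless it is empty.\<close>
  obtain \<epsilon> where \<epsilon>: "0 < \<epsilon>" "\<And>x. x \<in> D \<Longrightarrow> dist x z1 = \<rho> \<Longrightarrow> \<epsilon> \<le> w x"
  proof (cases "cball c 1 \<inter> sphere z1 \<rho> = {}")
    case True
    have "False" if "x \<in> D" "dist x z1 = \<rho>" for x
    proof -
      have "x \<in> cball c 1 \<inter> sphere z1 \<rho>" using that by (simp add: D_def dist_commute)
      with True show False by blast
    qed
    then show ?thesis by (intro that[of 1]) auto
  next
    case False
    have sub: "cball c 1 \<inter> sphere z1 \<rho> \<subseteq> D" by (auto simp: D_def)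
    have "compact (cball c 1 \<inter> sphere z1 \<rho>)" by (intro compact_Int compact_cball compact_sphere)
    then obtain y where y: "y \<in> cball c 1 \<inter> sphere z1 \<rho>"
        "\<And>x. x \<in> cball c 1 \<inter> sphere z1 \<rho> \<Longrightarrow> w y \<le> w x"
      using continuous_attains_inf[OF _ False continuous_on_subset[OF cD sub]] by blast
    show ?thesis
    proof (rule that[of "w y"])
      show "0 < w y" using y(1) sub \<rho> by (intro w_pos) auto
      show "w y \<le> w x" if "x \<in> D" "dist x z1 = \<rho>" for x
        using that by (intro y(2)) (auto simp: D_def dist_commute)
    qed
  qed
  define q where "q = (\<lambda>x. w x - \<epsilon> * hb x)"
  define gq where "gq = (\<lambda>x. (g2 x - g1 x) - \<epsilon> *\<^sub>R ((- 2 * k * E x) *\<^sub>R (x - c)))"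
  define Hq where "Hq = (\<lambda>x. (H2 x - H1 x) - \<epsilon> *\<^sub>R (E x *\<^sub>R ((4 * k\<^sup>2) *\<^sub>R outer (x - c) (x - c) - (2 * k) *\<^sub>R mat 1)))"
  have "C2_data S hb (\<lambda>x. (- 2 * k * E x) *\<^sub>R (x - c))
      (\<lambda>x. E x *\<^sub>R ((4 * k\<^sup>2) *\<^sub>R outer (x - c) (x - c) - (2 * k) *\<^sub>R mat 1))"
    unfolding hb_def E_def by (rule C2_data_subset[OF C2_data_barrier]) simp
  then have Dq: "C2_data S q gq Hq"
    unfolding q_def gq_def Hq_def by (intro C2_data_diff C2_data_scaleR Dw)
  \<comment> \<open>A negative minimum would be interior: the barrier vanishes on the sphere about
    \<open>c\<close>, and \<open>\<epsilon> * hb x \<le> \<epsilon> \<le> w x\<close> on the sphere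
    about \<open>z1\<close>.\<close>
  have q_nonneg: "0 \<le> q x" if "x \<in> D" for x
  proof -
    have "D \<noteq> {}" using that by blast
    moreover have "compact D" unfolding D_def by (intro compact_Int compact_cball)
    moreover have "continuous_on D q"
      using C2_data_isCont(1)[OF Dq S(1)] DS by (intro continuous_at_imp_continuous_on) auto
    ultimately obtain y where y: "y \<in> D" "\<And>x. x \<in> D \<Longrightarrow> q y \<le> q x"
      using continuous_attains_inf[of D q] by blast
    have "0 \<le> q y"
    proof (rule ccontr)
      assume neg: "\<not> 0 \<le> q y"
      have yS: "y \<in> S" by (rule DS[OF y(1)])
      have "dist c y \<noteq> 1"
      proof
        assume "dist c y = 1"
        then have "hb y = 0" by (simp add: hb_def E_def dist_norm norm_minus_commute)
        with neg w_nonneg[OF y(1)] show False by (simp add: q_def)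
      qed
      moreover have "dist z1 y \<noteq> \<rho>"
      proof
        assume "dist z1 y = \<rho>"
        then have "\<epsilon> \<le> w y" using \<epsilon>(2)[OF y(1)] by (simp add: dist_commute)
        moreover have "\<epsilon> * hb y \<le> \<epsilon> * 1"
          using \<epsilon> hb_le[of y] E(2)[of y] by (intro mult_left_mono) auto
        ultimately show False using neg by (simp add: q_def)
      qed
      ultimately have yN: "y \<in> ball c 1 \<inter> ball z1 \<rho>" using y(1) by (auto simp: D_def)
      have N: "open (ball c 1 \<inter> ball z1 \<rho>)" by (intro open_Int open_ball)
      have min: "\<forall>x\<in>ball c 1 \<inter> ball z1 \<rho>. q y \<le> q x" by (auto intro!: y(2) simp: D_def)
      have "(\<lambda>h. gq y \<bullet> h) = (\<lambda>h. 0)"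
        using differential_zero_maxmin[OF yN N C2_dataD(1)[OF Dq yS]] min by blast
      then have gq0: "gq y = 0" by (metis inner_eq_zero_iff)
      have sec: "0 \<le> v \<bullet> (Hq y *v v)" for v
      proof (rule C2_data_second_order_condition[OF Dq S(1) yS])
        show "gq y \<bullet> v = 0" by (simp add: gq0)
        have "((\<lambda>t. y + t *\<^sub>R v) \<longlongrightarrow> y) (at_right (0::real))" by (auto intro!: tendsto_eq_intros)
        from topological_tendstoD[OF this N yN]
        show "\<forall>\<^sub>F t in at_right 0. q y \<le> q (y + t *\<^sub>R v)"
          by eventually_elim (use min in blast)
      qed
      have s1: "H1 y \<in> sym_matrices" "H2 y \<in> sym_matrices"
        using eq1[OF yS] eq2[OF yS] pos[OF yS] U_sym schouten_sym_imp_hessian_sym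
        by (metis less_irrefl)+
      have psd: "pos_semidefinite (Hq y)"
        unfolding pos_semidefinite_def using sec s1
        by (auto simp: Hq_def intro!: sym_matrices_diff sym_matrices_scaleR outer_self_sym sym_matrices_mat)
      have nr: "dist y z1 < \<rho>0" using yN \<rho> by (simp add: dist_commute)
      note nry = near[OF nr]
      obtain a where a: "F (schouten f2 g2 H2 y) - F (schouten f1 g1 H1 y) =
            a \<bullet> (schouten f2 g2 H2 y - schouten f1 g1 H1 y)"
          "pos_definite a" "norm a \<le> T" "\<And>z. \<mu> * (norm z)\<^sup>2 \<le> z \<bullet> (a *v z)"
        using ell[of "schouten f1 g1 H1 y" "schouten f2 g2 H2 y"] eq1[OF yS] eq2[OF yS] nry by blast
      have "dist z1 c = 1" using z1c e by (simp add: dist_norm)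
      then have half: "1/2 \<le> norm (y - c)"
        using dist_triangle[of z1 c y] yN \<rho> by (simp add: dist_norm norm_minus_commute)
      show False
      proof (rule barrier_inequality)
        show "a \<bullet> ((f2 y *\<^sub>R H2 y - ((norm (g2 y))\<^sup>2 / 2) *\<^sub>R mat 1)
            - ((f2 y - w y) *\<^sub>R H1 y - ((norm (g1 y))\<^sup>2 / 2) *\<^sub>R mat 1)) = 0"
          using a(1) eq1[OF yS] eq2[OF yS] by (simp add: schouten_def w_def)
        show "g2 y - g1 y = \<epsilon> *\<^sub>R ((- 2 * k * E y) *\<^sub>R (y - c))"
          using gq0 unfolding gq_def by (simp only: right_minus_eq)
        show "pos_semidefinite (H2 y - H1 y - \<epsilon> *\<^sub>R (E y *\<^sub>R ((4 * k\<^sup>2) *\<^sub>R outer (y - c) (y - c) - (2 * k) *\<^sub>R mat 1)))"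
          using psd unfolding Hq_def .
        show "w y \<le> \<epsilon> * E y"
        proof -
          have "w y \<le> \<epsilon> * hb y" using neg by (simp add: q_def)
          also have "\<dots> \<le> \<epsilon> * E y" using \<epsilon> hb_le by (intro mult_left_mono) auto
          finally show ?thesis .
        qed
        show "norm (y - c) \<le> 1" using yN by (simp add: dist_norm norm_minus_commute)
        show "2 * M * T1 + T * K + K * T1 < k * m * \<mu>" using k by (simp add: B_def)
      qed (use a nry half w_nonneg[OF y(1)] mMK T \<epsilon> E k pos_definite_imp_semidefinite in
          \<open>auto simp: T1_def\<close>)
    qed
    with y(2)[OF that] show ?thesis by linarith
  qed
  \<comment> \<open>From its value 0 at \<open>z1\<close> the function \<open>q\<close> stays
    nonnegative towards \<open>c\<close>. Yet the gradients of \<open>f1\<close> and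
    \<open>f2\<close> cancel there, and what is left is minus \<open>\<epsilon>\<close> times the
    positive derivative of the barrier.\<close>
  have "((\<lambda>t. q (z1 + t *\<^sub>R e)) has_real_derivative gq z1 \<bullet> e) (at 0)"
  proof -
    have "((\<lambda>t. z1 + t *\<^sub>R e) has_derivative (\<lambda>h. h *\<^sub>R e)) (at 0)"
      by (auto intro!: derivative_eq_intros)
    from has_derivative_compose[OF this, of q "\<lambda>h. gq z1 \<bullet> h"] C2_dataD(1)[OF Dq S(2)]
    show ?thesis by (simp add: has_field_derivative_def mult_commute_abs)
  qed
  moreover have "gq z1 \<bullet> e < 0"
  proof -
    have "gq z1 \<bullet> e = - (\<epsilon> * 2 * k * E z1) * (e \<bullet> e)"
      unfolding gq_def contact z1c by simp
    moreover have "e \<bullet> e = 1" using e by (simp add: dot_square_norm)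
    ultimately show ?thesis using \<epsilon> k E(1)[of z1] by simp
  qed
  ultimately obtain d where d: "d > 0" "\<And>h. 0 < h \<Longrightarrow> h < d \<Longrightarrow> q (z1 + h *\<^sub>R e) < q z1"
    using DERIV_neg_dec_right[of "\<lambda>t. q (z1 + t *\<^sub>R e)" _ 0] by auto
  define t where "t = min (d / 2) \<rho>"
  have t: "0 < t" "t < d" "t \<le> \<rho>" "t \<le> 1" using d \<rho> by (auto simp: t_def)
  have "c - (z1 + t *\<^sub>R e) = (1 - t) *\<^sub>R e" by (simp add: z1e c_def algebra_simps)
  then have "z1 + t *\<^sub>R e \<in> D" using t e by (simp add: D_def dist_norm)
  then have "0 \<le> q (z1 + t *\<^sub>R e)" by (rule q_nonneg)
  moreover have "q z1 = 0"
  proof -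
    have "norm (z1 - c) = 1" using z1c e by simp
    then show ?thesis by (simp add: q_def w0 hb_def E_def)
  qed
  ultimately show False using d(2)[OF t(1,2)] by simp
qed

end

section \<open>Kelvin transform\<close>

definition inversion :: "real \<Rightarrow> real^'n \<Rightarrow> real^'n"
  where "inversion l z = (l\<^sup>2 / (norm z)\<^sup>2) *\<^sub>R z"

text \<open>Reflection in the hyperplane orthogonal to \<open>z\<close>. Up to the factor
  \<open>l\<^sup>2 / (norm z)\<^sup>2\<close> it is the derivative of the inversion at
  \<open>z\<close>.\<close>

definition reflection :: "real^'n \<Rightarrow> real^'n^'n"
  where "reflection z = mat 1 - (2 / (norm z)\<^sup>2) *\<^sub>R outer z z"

definition kelvin :: "real \<Rightarrow> (real^'n \<Rightarrow> real) \<Rightarrow> real^'n \<Rightarrow> real"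
  where "kelvin l f z = (norm z)\<^sup>2 / l\<^sup>2 * f (inversion l z)"

definition kelvin_gradient ::
    "real \<Rightarrow> (real^'n \<Rightarrow> real) \<Rightarrow> (real^'n \<Rightarrow> real^'n) \<Rightarrow> real^'n \<Rightarrow> real^'n"
  where "kelvin_gradient l f g z =
    (2 * f (inversion l z) / l\<^sup>2) *\<^sub>R z + reflection z *v g (inversion l z)"

definition kelvin_hessian ::
    "real \<Rightarrow> (real^'n \<Rightarrow> real) \<Rightarrow> (real^'n \<Rightarrow> real^'n) \<Rightarrow> (real^'n \<Rightarrow> real^'n^'n) \<Rightarrow> real^'n \<Rightarrow> real^'n^'n"
  where "kelvin_hessian l f g H z =
    (2 * f (inversion l z) / l\<^sup>2 - 2 * (z \<bullet> g (inversion l z)) / (norm z)\<^sup>2) *\<^sub>R mat 1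
    + (l\<^sup>2 / (norm z)\<^sup>2) *\<^sub>R (reflection z ** H (inversion l z) ** reflection z)"

lemma norm_inversion: "norm (inversion l z) = l\<^sup>2 / norm z"
  by (simp add: inversion_def power2_eq_square)

lemma inversion_inversion: "z \<noteq> 0 \<Longrightarrow> l \<noteq> 0 \<Longrightarrow> inversion l (inversion l z) = z"
  by (simp add: inversion_def[of l "inversion l z"] norm_inversion)
    (simp add: inversion_def power2_eq_square)

lemma inversion_fixed: "norm z = l \<Longrightarrow> z \<noteq> 0 \<Longrightarrow> inversion l z = z"
  by (auto simp: inversion_def)

lemma reflection_mult: "reflection z *v h = h - (2 * (z \<bullet> h) / (norm z)\<^sup>2) *\<^sub>R z"
  by (simp add: reflection_def matrix_vector_mult_diff_rdistrib scaleR_mult_vec outer_mult_vec)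

lemma reflection_sym: "reflection z \<in> sym_matrices"
  unfolding reflection_def
  by (intro sym_matrices_diff sym_matrices_mat sym_matrices_scaleR outer_self_sym)

lemma reflection_involutive: "z \<noteq> 0 \<Longrightarrow> reflection z *v (reflection z *v h) = h"
  by (simp add: reflection_mult inner_diff_right power2_norm_eq_inner diff_divide_distrib
      scaleR_diff_left[symmetric])

lemma inner_reflection: "x \<bullet> (reflection z *v y) = (reflection z *v x) \<bullet> y"
  using sym_matrices_inner_commute[OF reflection_sym] by (simp add: inner_commute)

lemma orthogonal_reflection:
  assumes "z \<noteq> 0"
  shows "orthogonal_matrix (reflection z)" "matrix_inv (reflection z) = reflection z"
proof -
  have inv: "reflection z ** reflection z = mat 1"
    using assms by (simp add: matrix_eq matrix_vector_mul_assoc[symmetric] reflection_involutive)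
  show "orthogonal_matrix (reflection z)"
    using inv reflection_sym[of z] by (simp add: orthogonal_matrix_def sym_matrices_def)
  have "reflection z ** matrix_inv (reflection z) = mat 1"
    unfolding matrix_inv_def by (rule someI2[of _ "reflection z"]) (use inv in auto)
  then have "reflection z ** reflection z ** matrix_inv (reflection z) = reflection z"
    by (simp add: matrix_mul_assoc[symmetric])
  then show "matrix_inv (reflection z) = reflection z" by (simp add: inv)
qed

section \<open>Derivatives of the inversion and of the Kelvin transform\<close>

lemma has_derivative_inversion:
  assumes "z \<noteq> 0"
  shows "(inversion l has_derivative (\<lambda>h. (l\<^sup>2 / (norm z)\<^sup>2) *\<^sub>R (reflection z *v h))) (at z)"
proof -
  have "((\<lambda>z. (l\<^sup>2 * inverse (z \<bullet> z)) *\<^sub>R z) has_derivative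
      (\<lambda>h. (l\<^sup>2 / (norm z)\<^sup>2) *\<^sub>R (reflection z *v h))) (at z)"
    using assms unfolding power2_norm_eq_inner
    by (auto intro!: derivative_eq_intros
        simp: reflection_mult power2_norm_eq_inner inner_commute algebra_simps divide_simps)
  then show ?thesis
    by (simp add: inversion_def[abs_def] power2_norm_eq_inner divide_inverse)
qed

lemma C2_data_kelvin:
  fixes f :: "real^'n \<Rightarrow> real"
  assumes C2: "C2_data UNIV f g H" and l: "0 < l"
  shows "C2_data (- {0}) (kelvin l f) (kelvin_gradient l f g) (kelvin_hessian l f g H)"
  unfolding C2_data_def
proof (intro conjI ballI)
  fix z :: "real^'n" assume "z \<in> - {0}"
  then have z: "z \<noteq> 0" and zz: "z \<bullet> z \<noteq> 0" by auto
  define J where "J = inversion l z"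
  define c where "c = l\<^sup>2 / (norm z)\<^sup>2"
  have c: "c * ((norm z)\<^sup>2 / l\<^sup>2) = 1" "0 < c" using z l by (simp_all add: c_def)
  note dJ = has_derivative_inversion[OF z, of l, folded c_def]
  have df: "((\<lambda>z. f (inversion l z)) has_derivative (\<lambda>h. g J \<bullet> (c *\<^sub>R (reflection z *v h)))) (at z)"
    using has_derivative_compose[OF dJ, of f "\<lambda>h. g J \<bullet> h"] C2_dataD(1)[OF C2] by (simp add: J_def)
  have dg: "((\<lambda>z. g (inversion l z)) has_derivative (\<lambda>h. H J *v (c *\<^sub>R (reflection z *v h)))) (at z)"
    using has_derivative_compose[OF dJ, of g "\<lambda>h. H J *v h"] C2_dataD(2)[OF C2] by (simp add: J_def)
  have NN: "(norm z)\<^sup>2 \<noteq> 0" using z by simp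
  have dN: "((\<lambda>z. (norm z)\<^sup>2) has_derivative (\<lambda>h. 2 * (z \<bullet> h))) (at z)"
    unfolding power2_norm_eq_inner
    by (auto intro!: derivative_eq_intros simp: inner_commute)
  show "(kelvin l f has_derivative (\<lambda>h. kelvin_gradient l f g z \<bullet> h)) (at z)"
  proof -
    have "((\<lambda>z. (norm z)\<^sup>2 * (1 / l\<^sup>2) * f (inversion l z)) has_derivative
        (\<lambda>h. (norm z)\<^sup>2 * (1 / l\<^sup>2) * (g J \<bullet> (c *\<^sub>R (reflection z *v h)))
          + 2 * (z \<bullet> h) * (1 / l\<^sup>2) * f J)) (at z)"
      unfolding J_def by (rule has_derivative_mult[OF has_derivative_mult_left[OF dN] df[unfolded J_def]])
    moreover have "(norm z)\<^sup>2 * (1 / l\<^sup>2) * (g J \<bullet> (c *\<^sub>R (reflection z *v h)))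
          + 2 * (z \<bullet> h) * (1 / l\<^sup>2) * f J = kelvin_gradient l f g z \<bullet> h" for h
    proof -
      have "(norm z)\<^sup>2 * (1 / l\<^sup>2) * (g J \<bullet> (c *\<^sub>R (reflection z *v h))) =
          c * ((norm z)\<^sup>2 / l\<^sup>2) * (g J \<bullet> (reflection z *v h))" by simp
      then show ?thesis
        unfolding c inner_reflection
        by (simp add: kelvin_gradient_def J_def[symmetric] inner_add_left)
    qed
    ultimately show ?thesis by (simp add: kelvin_def[abs_def])
  qed
  show "(kelvin_gradient l f g has_derivative (\<lambda>h. kelvin_hessian l f g H z *v h)) (at z)"
  proof -
    have "((\<lambda>z. (2 / l\<^sup>2 * f (inversion l z)) *\<^sub>R z +
        (g (inversion l z) - (2 * (z \<bullet> g (inversion l z)) * inverse ((norm z)\<^sup>2)) *\<^sub>R z))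
      has_derivative (\<lambda>h. ((2 / l\<^sup>2 * f J) *\<^sub>R h + (2 / l\<^sup>2 * (g J \<bullet> (c *\<^sub>R (reflection z *v h)))) *\<^sub>R z)
        + (H J *v (c *\<^sub>R (reflection z *v h)) -
          ((2 * (z \<bullet> g J) * inverse ((norm z)\<^sup>2)) *\<^sub>R h +
           (2 * (z \<bullet> g J) * (- (inverse ((norm z)\<^sup>2) * (2 * (z \<bullet> h)) * inverse ((norm z)\<^sup>2)))
           + 2 * (z \<bullet> (H J *v (c *\<^sub>R (reflection z *v h))) + h \<bullet> g J) * inverse ((norm z)\<^sup>2)) *\<^sub>R z)))) (at z)"
      unfolding J_def
      by (rule has_derivative_add[OF
            has_derivative_scaleR[OF has_derivative_mult_right[OF df[unfolded J_def]] has_derivative_ident]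
            has_derivative_diff[OF dg[unfolded J_def]
              has_derivative_scaleR[OF has_derivative_mult[OF
                has_derivative_mult_right[OF has_derivative_inner[OF has_derivative_ident dg[unfolded J_def]]]
                Deriv.has_derivative_inverse[OF NN dN]] has_derivative_ident]]])
    moreover have "((2 / l\<^sup>2 * f J) *\<^sub>R h + (2 / l\<^sup>2 * (g J \<bullet> (c *\<^sub>R (reflection z *v h)))) *\<^sub>R z)
        + (H J *v (c *\<^sub>R (reflection z *v h)) -
          ((2 * (z \<bullet> g J) * inverse ((norm z)\<^sup>2)) *\<^sub>R h +
           (2 * (z \<bullet> g J) * (- (inverse ((norm z)\<^sup>2) * (2 * (z \<bullet> h)) * inverse ((norm z)\<^sup>2)))
           + 2 * (z \<bullet> (H J *v (c *\<^sub>R (reflection z *v h))) + h \<bullet> g J) * inverse ((norm z)\<^sup>2)) *\<^sub>R z))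
        = kelvin_hessian l f g H z *v h" for h
    proof -
      define N where "N = (norm z)\<^sup>2"
      define K where "K = H J *v (c *\<^sub>R (reflection z *v h))"
      have cl: "c / l\<^sup>2 = 1 / N" "N \<noteq> 0" using l z by (simp_all add: c_def N_def)
      \<comment> \<open>Both terms on the right cancel against those that arise from differentiating
        the reflection inside \<open>kelvin_gradient\<close>. A multiple of \<open>h\<close> and the
        conjugated Hessian remain, which explains the form of \<open>kelvin_hessian\<close>.\<close>
      have "2 / l\<^sup>2 * (g J \<bullet> (c *\<^sub>R (reflection z *v h))) = 2 * (c / l\<^sup>2) * (g J \<bullet> (reflection z *v h))"
        by simp
      also have "\<dots> = 2 / N * (g J \<bullet> h) - 4 * (z \<bullet> h) * (z \<bullet> g J) / (N * N)"
        unfolding cl reflection_mult N_def[symmetric] using cl(2)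
        by (simp add: inner_diff_right inner_commute field_simps)
      finally have 1: "2 / l\<^sup>2 * (g J \<bullet> (c *\<^sub>R (reflection z *v h))) =
        2 / N * (g J \<bullet> h) - 4 * (z \<bullet> h) * (z \<bullet> g J) / (N * N)" .
      have 2: "kelvin_hessian l f g H z *v h = (2 / l\<^sup>2 * f J - 2 * (z \<bullet> g J) / N) *\<^sub>R h +
          (K - (2 * (z \<bullet> K) / N) *\<^sub>R z)"
      proof -
        have "c *\<^sub>R (reflection z *v (H J *v (reflection z *v h))) = reflection z *v K"
          by (simp add: K_def matrix_vector_mult_scaleR)
        also have "\<dots> = K - (2 * (z \<bullet> K) / N) *\<^sub>R z" by (simp add: reflection_mult N_def)
        finally show ?thesis
          by (simp add: kelvin_hessian_def matrix_vector_mult_add_rdistrib scaleR_mult_vec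
              J_def[symmetric] N_def[symmetric] c_def[folded N_def, symmetric]
              matrix_vector_mul_assoc[symmetric])
      qed
      show ?thesis
        unfolding 1 2 K_def[symmetric] N_def[symmetric]
        by (simp add: algebra_simps divide_inverse inner_commute)
    qed
    ultimately show ?thesis
      by (simp add: kelvin_gradient_def[abs_def] reflection_mult divide_inverse mult_ac)
  qed
next
  have cJ: "continuous_on (- {0}) (inversion l)"
    using has_derivative_inversion has_derivative_continuous
    by (intro continuous_at_imp_continuous_on) blast
  have f: "continuous_on UNIV f" and g: "continuous_on UNIV g" and H: "continuous_on UNIV H"
    using C2_data_isCont[OF C2] by (auto intro!: continuous_at_imp_continuous_on)
  note comp = continuous_on_compose2[OF f cJ subset_UNIV] continuous_on_compose2[OF g cJ subset_UNIV]
    continuous_on_compose2[OF H cJ subset_UNIV]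
  have R: "continuous_on (- {0}) (\<lambda>z. reflection z)"
    unfolding reflection_def outer_def by (auto intro!: continuous_intros)
  show "continuous_on (- {0}) (kelvin_hessian l f g H)"
    unfolding kelvin_hessian_def[abs_def] matrix_matrix_mult_def
    using l by (auto intro!: continuous_intros comp R)
qed

text \<open>Conformal covariance: \<open>kelvin l f\<close> belongs to the pullback of the metric
  \<open>f^-2 |dx|^2\<close> under the inversion, whose derivative is a multiple of
  \<open>reflection z\<close>. As the matrix is merely conjugated by an orthogonal one, the
  invariance of \<open>U\<close> and \<open>F\<close> makes Kelvin transforms solutions.\<close>

lemma schouten_kelvin:
  fixes f :: "real^'n \<Rightarrow> real"
  assumes z: "z \<noteq> 0" and l: "0 < l"
  shows "schouten (kelvin l f) (kelvin_gradient l f g) (kelvin_hessian l f g H) z =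
    matrix_inv (reflection z) ** schouten f g H (inversion l z) ** reflection z"
proof -
  define N where "N = (norm z)\<^sup>2"
  define p where "p = f (inversion l z)"
  define G where "G = g (inversion l z)"
  define Q where "Q = H (inversion l z)"
  have N: "N \<noteq> 0" "z \<bullet> z = N" using z by (simp_all add: N_def power2_norm_eq_inner)
  have zr: "z \<bullet> (reflection z *v G) = - (z \<bullet> G)"
    using N by (simp add: reflection_mult inner_diff_right N_def[symmetric])
  have rr: "(reflection z *v G) \<bullet> (reflection z *v G) = (norm G)\<^sup>2"
    using z by (simp add: inner_reflection reflection_involutive power2_norm_eq_inner)
  have "(norm (kelvin_gradient l f g z))\<^sup>2 = (2 * p / l\<^sup>2) * (2 * p / l\<^sup>2) * (z \<bullet> z)
      + 2 * (2 * p / l\<^sup>2) * (z \<bullet> (reflection z *v G)) + (reflection z *v G) \<bullet> (reflection z *v G)"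
    unfolding kelvin_gradient_def power2_norm_eq_inner p_def[symmetric] G_def[symmetric]
    by (simp add: inner_add_left inner_add_right inner_commute[of "reflection z *v G" z]
        algebra_simps)
  then have ng: "(norm (kelvin_gradient l f g z))\<^sup>2 =
      4 * p\<^sup>2 * N / l ^ 4 - 4 * p * (z \<bullet> G) / l\<^sup>2 + (norm G)\<^sup>2"
    unfolding zr rr N(2) by (simp add: power2_eq_square power4_eq_xxxx)
  have collect: "c1 *\<^sub>R (c2 *\<^sub>R x + c3 *\<^sub>R X) - c4 *\<^sub>R x =
      (c1 * c2 - c4) *\<^sub>R x + (c1 * c3) *\<^sub>R X" for x X :: "real^'n" and c1 c2 c3 c4
    by (simp add: algebra_simps)
  have "(schouten (kelvin l f) (kelvin_gradient l f g) (kelvin_hessian l f g H) z) *v x =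
    (matrix_inv (reflection z) ** schouten f g H (inversion l z) ** reflection z) *v x" for x
  proof -
    define X where "X = reflection z *v (Q *v (reflection z *v x))"
    have "(schouten (kelvin l f) (kelvin_gradient l f g) (kelvin_hessian l f g H) z) *v x =
        (N / l\<^sup>2 * p) *\<^sub>R ((2 * p / l\<^sup>2 - 2 * (z \<bullet> G) / N) *\<^sub>R x + (l\<^sup>2 / N) *\<^sub>R X)
        - ((4 * p\<^sup>2 * N / l ^ 4 - 4 * p * (z \<bullet> G) / l\<^sup>2 + (norm G)\<^sup>2) / 2) *\<^sub>R x"
      unfolding schouten_def ng kelvin_def kelvin_hessian_def p_def[symmetric] G_def[symmetric]
        N_def[symmetric] Q_def[symmetric] X_def
      by (simp add: matrix_vector_mult_add_rdistrib matrix_vector_mult_diff_rdistrib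
          scaleR_mult_vec matrix_vector_mul_assoc[symmetric])
    also have "\<dots> = (N / l\<^sup>2 * p * (2 * p / l\<^sup>2 - 2 * (z \<bullet> G) / N)
          - (4 * p\<^sup>2 * N / l ^ 4 - 4 * p * (z \<bullet> G) / l\<^sup>2 + (norm G)\<^sup>2) / 2) *\<^sub>R x
        + (N / l\<^sup>2 * p * (l\<^sup>2 / N)) *\<^sub>R X"
      by (rule collect)
    also have "N / l\<^sup>2 * p * (l\<^sup>2 / N) = p" using N l by simp
    \<comment> \<open>All contributions of \<open>p\<close> to the multiple of the identity cancel
      against the square of \<open>kelvin_gradient\<close>; only the gradient of \<open>f\<close>
      survives.\<close>
    also have "N / l\<^sup>2 * p * (2 * p / l\<^sup>2 - 2 * (z \<bullet> G) / N)
          - (4 * p\<^sup>2 * N / l ^ 4 - 4 * p * (z \<bullet> G) / l\<^sup>2 + (norm G)\<^sup>2) / 2 = - ((norm G)\<^sup>2 / 2)"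
      using N l by (simp add: field_simps power2_eq_square power4_eq_xxxx)
    finally show ?thesis
      using z unfolding orthogonal_reflection(2)[OF z] schouten_def p_def[symmetric]
        G_def[symmetric] Q_def[symmetric] X_def
      by (simp add: matrix_vector_mul_assoc[symmetric] matrix_vector_mult_diff_rdistrib
          scaleR_mult_vec matrix_vector_mult_diff_distrib matrix_vector_mult_scaleR
          reflection_involutive)
  qed
  then show ?thesis by (simp add: matrix_eq)
qed

section \<open>Moving spheres\<close>

text \<open>The coefficients at infinity are parameters so that the results apply to translates of
  \<open>f\<close>: moving the centre preserves \<open>\<gamma>\<close> and shifts
  \<open>\<beta>\<close>.\<close>

locale entire_solution = elliptic_equation U F
  for U :: "(real^'n^'n) set" and F :: "real^'n^'n \<Rightarrow> real" +
  fixes f :: "real^'n \<Rightarrow> real"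
    and g :: "real^'n \<Rightarrow> real^'n"
    and H :: "real^'n \<Rightarrow> real^'n^'n"
    and \<gamma> :: real
    and \<beta> :: "real^'n"
  assumes C2: "C2_data UNIV f g H"
    and pos: "0 < f x"
    and eq: "schouten f g H x \<in> U \<and> F (schouten f g H x) = 1"
    and gamma: "0 < \<gamma>"
    and expansion: "((\<lambda>z. (f z - \<gamma> * (norm z)\<^sup>2 - \<beta> \<bullet> z) / norm z) \<longlongrightarrow> 0) at_infinity"
begin

section \<open>Comparison with the Kelvin transform and exclusion of contact\<close>

lemma f_deriv: "(f has_derivative (\<lambda>h. g x \<bullet> h)) (at x)"
  and f_cont: "isCont f x" and g_cont: "isCont g x"
  using C2_dataD(1)[OF C2] C2_data_isCont[OF C2 open_UNIV] by auto

lemma kelvin_solution: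
  assumes "z \<noteq> 0" "0 < l"
  shows "schouten (kelvin l f) (kelvin_gradient l f g) (kelvin_hessian l f g H) z \<in> U"
    and "F (schouten (kelvin l f) (kelvin_gradient l f g) (kelvin_hessian l f g H) z) = 1"
proof -
  let ?M = "schouten f g H (inversion l z)"
  note Q = orthogonal_reflection(1)[OF assms(1)]
  have "?M \<in> U" "F ?M = 1" using eq by auto
  then show "F (schouten (kelvin l f) (kelvin_gradient l f g) (kelvin_hessian l f g H) z) = 1"
    using F_inv[OF _ Q] by (simp add: schouten_kelvin assms)
  have "matrix_inv (reflection z) ** ?M ** reflection z \<in> (\<lambda>M. matrix_inv (reflection z) ** M ** reflection z) ` U"
    using \<open>?M \<in> U\<close> by blast
  then show "schouten (kelvin l f) (kelvin_gradient l f g) (kelvin_hessian l f g H) z \<in> U"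
    unfolding U_inv[OF Q] by (simp add: schouten_kelvin assms)
qed

lemma kelvin_pos: "z \<noteq> 0 \<Longrightarrow> 0 < l \<Longrightarrow> 0 < kelvin l f z"
  using pos by (simp add: kelvin_def)

lemma kelvin_on_sphere: "norm z = l \<Longrightarrow> 0 < l \<Longrightarrow> kelvin l f z = f z"
  using inversion_fixed[of z l] by (auto simp: kelvin_def)

lemma kelvin_gradient_on_sphere:
  assumes "norm z = l" "0 < l"
  shows "kelvin_gradient l f g z = g z + (2 * (f z - z \<bullet> g z) / l\<^sup>2) *\<^sub>R z"
proof -
  have "inversion l z = z" using assms by (intro inversion_fixed) auto
  then show ?thesis
    using assms by (simp add: kelvin_gradient_def reflection_mult algebra_simps diff_divide_distrib)
qed

text \<open>In terms of \<open>u\<close>, where the negative power reverses the order: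
  \<open>u\<close> dominates its Kelvin transform outside the sphere of radius
  \<open>l\<close>.\<close>

definition below :: "real \<Rightarrow> bool"
  where "below l \<longleftrightarrow> (\<forall>z. l \<le> norm z \<longrightarrow> f z \<le> kelvin l f z)"

text \<open>The inversion exchanges the two sides of the sphere and the Kelvin transform is an
  involution, so the inequality reverses inside.\<close>

lemma below_inside:
  assumes l: "0 < l" "below l" and z: "z \<noteq> 0" "norm z \<le> l"
  shows "kelvin l f z \<le> f z"
proof -
  define y where "y = inversion l z"
  have "l * norm z \<le> l * l" using z l by (intro mult_left_mono) auto
  then have "l \<le> norm y" using z by (simp add: y_def norm_inversion field_simps power2_eq_square)
  then have "f y \<le> kelvin l f y" using l by (simp add: below_def)
  also have "\<dots> = l\<^sup>2 / (norm z)\<^sup>2 * f z"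
    using z l by (simp add: kelvin_def y_def norm_inversion inversion_inversion power2_eq_square)
  finally have "(norm z)\<^sup>2 / l\<^sup>2 * f y \<le> (norm z)\<^sup>2 / l\<^sup>2 * (l\<^sup>2 / (norm z)\<^sup>2 * f z)"
    by (intro mult_left_mono) auto
  then show ?thesis using z l by (simp add: kelvin_def y_def)
qed

text \<open>
  On the sphere \<open>norm z = l\<close> the difference of \<open>kelvin l f\<close> and \<open>f\<close> changes sign, so its Hessian at a
  critical point there vanishes in every direction.
\<close>

lemma no_contact:
  assumes l: "0 < l" "below l" and z1: "l \<le> norm z1" "kelvin l f z1 = f z1"
    and less: "\<And>z. norm z1 < norm z \<Longrightarrow> f z < kelvin l f z"
    and radial: "norm z1 = l \<Longrightarrow> f z1 = z1 \<bullet> g z1"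
  shows False
proof -
  define fl where "fl = kelvin l f"
  define gl where "gl = kelvin_gradient l f g"
  define Hl where "Hl = kelvin_hessian l f g H"
  have z10: "z1 \<noteq> 0" using l z1 by auto
  \<comment> \<open>This radius keeps the neighbourhood away from the origin, where the Kelvin
    transform is singular.\<close>
  define S where "S = ball z1 (norm z1)"
  have S: "open S" "z1 \<in> S" "S \<subseteq> - {0}" using z10 by (auto simp: S_def)
  have D: "C2_data S f g H" using C2_data_subset[OF C2] by simp
  have Dl: "C2_data S fl gl Hl"
    using C2_data_subset[OF C2_data_kelvin[OF C2 l(1)] S(3)] by (simp add: fl_def gl_def Hl_def)
  have Dw: "C2_data S (\<lambda>x. fl x - f x) (\<lambda>x. gl x - g x) (\<lambda>x. Hl x - H x)"
    by (rule C2_data_diff[OF Dl D])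
  have Dw': "C2_data S (\<lambda>x. f x - fl x) (\<lambda>x. g x - gl x) (\<lambda>x. H x - Hl x)"
    by (rule C2_data_diff[OF D Dl])
  have w0: "fl z1 = f z1" using z1 by (simp add: fl_def)
  have outside: "f z \<le> fl z" if "l \<le> norm z" for z using l that by (simp add: below_def fl_def)
  have sol: "schouten fl gl Hl x \<in> U \<and> F (schouten fl gl Hl x) = 1" if "x \<in> S" for x
    using kelvin_solution[of x l] S that l by (auto simp: fl_def gl_def Hl_def)
  have Hsym: "H z1 \<in> sym_matrices" "Hl z1 \<in> sym_matrices"
    using schouten_sym_imp_hessian_sym U_sym eq[of z1] sol[OF S(2)] pos[of z1] w0
    by (metis less_irrefl)+
  have line: "((\<lambda>t. z1 + t *\<^sub>R v) \<longlongrightarrow> z1) (at_right (0::real))" for v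
    by (auto intro!: tendsto_eq_intros)
  \<comment> \<open>On the sphere the gradients differ by a radial vector, which the assumption
    \<open>radial\<close> removes. Off the sphere \<open>z1\<close> is an interior minimum of the
    difference.\<close>
  have g_eq: "gl z1 = g z1"
  proof (cases "norm z1 = l")
    case True
    then show ?thesis
      using kelvin_gradient_on_sphere[OF True l(1)] radial by (simp add: gl_def)
  next
    case False
    have N: "z1 \<in> {z. l < norm z}" "open {z::real^'n. l < norm z}"
      using z1 False by (auto intro!: open_Collect_less continuous_intros)
    have "(\<lambda>h. (gl z1 - g z1) \<bullet> h) = (\<lambda>h. 0)"
      using differential_zero_maxmin[OF N C2_dataD(1)[OF Dw S(2)]] outside w0 by auto
    then have "gl z1 - g z1 = 0" by (metis inner_eq_zero_iff)
    then show ?thesis by simp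
  qed
  have H_eq: "Hl z1 = H z1"
  proof (cases "norm z1 = l")
    case True
    have out: "0 \<le> v \<bullet> ((Hl z1 - H z1) *v v)" if v: "0 < z1 \<bullet> v" for v
    proof (rule C2_data_second_order_condition[OF Dw S(1,2)])
      show "\<forall>\<^sub>F t in at_right 0. fl z1 - f z1 \<le> fl (z1 + t *\<^sub>R v) - f (z1 + t *\<^sub>R v)"
        using eventually_at_right_less[of 0]
      proof eventually_elim
        case (elim t)
        have "(norm (z1 + t *\<^sub>R v))\<^sup>2 = (norm z1)\<^sup>2 + 2 * t * (z1 \<bullet> v) + t\<^sup>2 * (v \<bullet> v)"
          unfolding power2_norm_eq_inner
          by (simp add: inner_add_left inner_add_right inner_commute power2_eq_square)
        then have "(norm z1)\<^sup>2 \<le> (norm (z1 + t *\<^sub>R v))\<^sup>2" using elim v by simp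
        then have "l \<le> norm (z1 + t *\<^sub>R v)" using True by (simp add: power2_le_iff_abs_le)
        then show ?case using outside w0 by simp
      qed
    qed (simp add: g_eq)
    have ins: "0 \<le> v \<bullet> ((H z1 - Hl z1) *v v)" if v: "z1 \<bullet> v < 0" for v
    proof (rule C2_data_second_order_condition[OF Dw' S(1,2)])
      have "((\<lambda>t. t * (v \<bullet> v)) \<longlongrightarrow> 0) (at_right 0)" by (auto intro!: tendsto_eq_intros)
      then have "\<forall>\<^sub>F t in at_right 0. t * (v \<bullet> v) < - 2 * (z1 \<bullet> v)"
        using v by (intro order_tendstoD(2)) auto
      moreover have "\<forall>\<^sub>F t in at_right 0. z1 + t *\<^sub>R v \<in> - {0}"
        using z10 by (intro topological_tendstoD[OF line]) auto
      ultimately show "\<forall>\<^sub>F t in at_right 0. f z1 - fl z1 \<le> f (z1 + t *\<^sub>R v) - fl (z1 + t *\<^sub>R v)"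
        using eventually_at_right_less[of 0]
      proof eventually_elim
        case (elim t)
        have "(norm (z1 + t *\<^sub>R v))\<^sup>2 = (norm z1)\<^sup>2 + t * (2 * (z1 \<bullet> v) + t * (v \<bullet> v))"
          unfolding power2_norm_eq_inner
          by (simp add: inner_add_left inner_add_right inner_commute algebra_simps)
        moreover have "t * (2 * (z1 \<bullet> v) + t * (v \<bullet> v)) \<le> 0"
          using elim by (intro mult_nonneg_nonpos) auto
        ultimately have "(norm (z1 + t *\<^sub>R v))\<^sup>2 \<le> (norm z1)\<^sup>2" by simp
        then have "norm (z1 + t *\<^sub>R v) \<le> l" using True power2_le_imp_le norm_ge_zero by blast
        then show ?case using below_inside[OF l] elim w0 by (simp add: fl_def)
      qed
    qed (simp add: g_eq)
    define B where "B = Hl z1 - H z1"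
    have Bsym: "B \<in> sym_matrices" unfolding B_def by (intro sym_matrices_diff Hsym)
    have B': "H z1 - Hl z1 = - B" by (simp add: B_def)
    have minus: "v \<bullet> ((- B) *v v) = - (v \<bullet> (B *v v))" for v
      using matrix_vector_mult_diff_rdistrib[of 0 B v] by simp
    have uminus: "(- v) \<bullet> (B *v (- v)) = v \<bullet> (B *v v)" for v
      using matrix_vector_mult_diff_distrib[of B 0 v] by simp
    have nz: "v \<bullet> (B *v v) = 0" if "z1 \<bullet> v \<noteq> 0" for v
    proof -
      have "0 \<le> v \<bullet> (B *v v)" "v \<bullet> (B *v v) \<le> 0" if "0 < z1 \<bullet> v" for v
        using out[OF that] ins[of "- v"] that unfolding B' minus uminus
        by (simp_all add: B_def[symmetric])
      from this[of v] this[of "- v", unfolded uminus] that show ?thesis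
        by (cases "0 < z1 \<bullet> v") auto
    qed
    \<comment> \<open>A tangential \<open>v\<close> is reached from the transversal directions
      \<open>v + z1\<close> and \<open>v - z1\<close> by the parallelogram identity.\<close>
    have "v \<bullet> (B *v v) = 0" for v
    proof (cases "z1 \<bullet> v = 0")
      case True
      have z11: "z1 \<bullet> z1 \<noteq> 0" using z10 by simp
      have "(v + z1) \<bullet> (B *v (v + z1)) = 0" "(v - z1) \<bullet> (B *v (v - z1)) = 0" "z1 \<bullet> (B *v z1) = 0"
        using True z11 by (auto intro!: nz simp: inner_add_right inner_diff_right)
      then show ?thesis
        by (simp add: matrix_vector_right_distrib matrix_vector_mult_diff_distrib
            inner_add_left inner_diff_left inner_add_right inner_diff_right)
    qed (rule nz)
    then have "B = 0" by (rule sym_quadratic_form_eq_0[OF Bsym])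
    then show ?thesis by (simp add: B_def)
  next
    case False
    have N: "z1 \<in> {z. l < norm z}" "open {z::real^'n. l < norm z}"
      using z1 False by (auto intro!: open_Collect_less continuous_intros)
    have "0 \<le> v \<bullet> ((Hl z1 - H z1) *v v)" for v
    proof (rule C2_data_second_order_condition[OF Dw S(1,2)])
      from topological_tendstoD[OF line[of v] N(2,1)]
      show "\<forall>\<^sub>F t in at_right 0. fl z1 - f z1 \<le> fl (z1 + t *\<^sub>R v) - f (z1 + t *\<^sub>R v)"
        by eventually_elim (use outside w0 in auto)
    qed (simp add: g_eq)
    \<comment> \<open>With equal values and gradients the two matrices differ by exactly this
      matrix, and both satisfy the equation; this is the situation of
      \<open>touching_eq\<close>.\<close>
    then have "pos_semidefinite (f z1 *\<^sub>R (Hl z1 - H z1))"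
      using Hsym pos[of z1]
      by (intro pos_semidefinite_scaleR) (auto simp: pos_semidefinite_def intro: sym_matrices_diff)
    moreover have "schouten f g H z1 + f z1 *\<^sub>R (Hl z1 - H z1) = schouten fl gl Hl z1"
      by (simp add: schouten_def w0 g_eq algebra_simps)
    ultimately have "f z1 *\<^sub>R (Hl z1 - H z1) = 0"
      using touching_eq[of "schouten f g H z1" "f z1 *\<^sub>R (Hl z1 - H z1)"] eq sol[OF S(2)]
      by (simp only:)
    then show ?thesis using pos[of z1] by simp
  qed
  show False
  proof (rule hopf_contact[OF S(1,2) z10 D Dl])
    show "0 < fl x" if "x \<in> S" for x using S(3) that l by (auto simp: fl_def intro!: kelvin_pos)
    show "f x < fl x" if "norm z1 < norm x" for x using less[OF that] by (simp add: fl_def)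
  qed (use pos eq sol w0 g_eq H_eq in auto)
qed

section \<open>Strict comparison near infinity and off the sphere\<close>

lemma quadratic_growth:
  assumes "0 < \<eta>"
  obtains R where "0 < R" "\<And>z. R \<le> norm z \<Longrightarrow> f z < (\<gamma> + \<eta>) * (norm z)\<^sup>2"
proof -
  have "\<forall>\<^sub>F z in at_infinity. dist ((f z - \<gamma> * (norm z)\<^sup>2 - \<beta> \<bullet> z) / norm z) 0 < 1"
    using expansion by (rule tendstoD) simp
  then obtain R0 where R0: "\<And>z. R0 \<le> norm z \<Longrightarrow> dist ((f z - \<gamma> * (norm z)\<^sup>2 - \<beta> \<bullet> z) / norm z) 0 < 1"
    unfolding eventually_at_infinity by blast
  define R where "R = max \<bar>R0\<bar> ((1 + norm \<beta>) / \<eta>) + 1"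
  show ?thesis
  proof (rule that[of R])
    show "0 < R" by (simp add: R_def)
    fix z :: "real^'n" assume z: "R \<le> norm z"
    then have z0: "0 < norm z" "R0 \<le> norm z" "(1 + norm \<beta>) / \<eta> < norm z" by (auto simp: R_def)
    then have "1 + norm \<beta> < \<eta> * norm z" using assms by (simp add: field_simps)
    then have "(1 + norm \<beta>) * norm z < \<eta> * norm z * norm z" using z0(1) by (rule mult_strict_right_mono)
    moreover have "f z - \<gamma> * (norm z)\<^sup>2 - \<beta> \<bullet> z \<le> norm z"
      using R0[OF z0(2)] z0(1) by (simp add: abs_less_iff field_simps)
    moreover have "\<beta> \<bullet> z \<le> norm \<beta> * norm z" by (rule norm_cauchy_schwarz)
    ultimately show "f z < (\<gamma> + \<eta>) * (norm z)\<^sup>2" by (simp add: algebra_simps power2_eq_square)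
  qed
qed

text \<open>Divided by \<open>(norm z)\<^sup>2\<close>, the Kelvin transform tends to
  \<open>f 0 / \<mu>\<^sup>2\<close> and \<open>f\<close> tends to \<open>\<gamma>\<close>. The
  bound is uniform in radii slightly above \<open>l\<close>, because increasing the radius requires
  one \<open>R\<close> for all of them.\<close>

lemma strict_at_infinity:
  assumes l: "0 < l" and less: "\<gamma> * l\<^sup>2 < f 0"
  obtains R l' where "0 < R" "l < l'"
    "\<And>\<mu> z. l \<le> \<mu> \<Longrightarrow> \<mu> < l' \<Longrightarrow> R \<le> norm z \<Longrightarrow> f z < kelvin \<mu> f z"
proof -
  \<comment> \<open>A single \<open>\<eta>\<close> measures the error in the growth rate, in the
    radius and in the values of \<open>f\<close> near the origin.\<close>
  have "((\<lambda>\<eta>. (\<gamma> + \<eta>) * (l + \<eta>)\<^sup>2 - (f 0 - \<eta>)) \<longlongrightarrow> \<gamma> * l\<^sup>2 - f 0) (at_right 0)"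
    by (auto intro!: tendsto_eq_intros)
  then have "\<forall>\<^sub>F \<eta> in at_right 0. (\<gamma> + \<eta>) * (l + \<eta>)\<^sup>2 - (f 0 - \<eta>) < 0"
    using less by (intro order_tendstoD(2)) auto
  then have "\<forall>\<^sub>F \<eta> in at_right 0. (\<gamma> + \<eta>) * (l + \<eta>)\<^sup>2 - (f 0 - \<eta>) < 0 \<and> 0 < \<eta>"
    using eventually_at_right_less by (rule eventually_conj)
  then obtain \<eta> where \<eta>: "0 < \<eta>" "(\<gamma> + \<eta>) * (l + \<eta>)\<^sup>2 < f 0 - \<eta>"
    using eventually_happens'[OF trivial_limit_at_right_real[of 0]] by force
  obtain R1 where R1: "0 < R1" "\<And>z. R1 \<le> norm z \<Longrightarrow> f z < (\<gamma> + \<eta>) * (norm z)\<^sup>2"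
    using quadratic_growth[OF \<eta>(1)] by blast
  obtain d where d: "0 < d" "\<And>y. dist y 0 < d \<Longrightarrow> dist (f y) (f 0) < \<eta>"
    using f_cont[of 0] \<eta>(1) unfolding continuous_at_eps_delta by (metis dist_norm diff_zero)
  define l' where "l' = l + \<eta>"
  define R where "R = max R1 (l'\<^sup>2 / d + 1)"
  show ?thesis
  proof (rule that[of R l'])
    show "0 < R" "l < l'" using R1 \<eta> by (auto simp: R_def l'_def)
    fix \<mu> and z :: "real^'n" assume \<mu>: "l \<le> \<mu>" "\<mu> < l'" and z: "R \<le> norm z"
    have z0: "0 < norm z" "R1 \<le> norm z" "l'\<^sup>2 / d < norm z" using R1 z by (auto simp: R_def)
    have \<mu>2: "0 < \<mu>" "\<mu>\<^sup>2 \<le> l'\<^sup>2" using \<mu> l by (auto intro!: power_mono)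
    have "l'\<^sup>2 < norm z * d" using z0 d by (simp add: field_simps)
    then have "norm (inversion \<mu> z) < d"
      using \<mu>2 z0 by (simp add: norm_inversion field_simps)
    then have "f 0 - \<eta> < f (inversion \<mu> z)" using d(2)[of "inversion \<mu> z"] by (simp add: dist_norm)
    with \<eta>(2) have "(\<gamma> + \<eta>) * l'\<^sup>2 < f (inversion \<mu> z)" by (simp add: l'_def)
    moreover have "(\<gamma> + \<eta>) * \<mu>\<^sup>2 \<le> (\<gamma> + \<eta>) * l'\<^sup>2"
      using \<mu>2 gamma \<eta> by (intro mult_left_mono) auto
    ultimately have "(\<gamma> + \<eta>) * \<mu>\<^sup>2 * ((norm z)\<^sup>2 / \<mu>\<^sup>2) < f (inversion \<mu> z) * ((norm z)\<^sup>2 / \<mu>\<^sup>2)"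
      using z0 \<mu>2 by (intro mult_strict_right_mono) auto
    then have "(\<gamma> + \<eta>) * (norm z)\<^sup>2 < kelvin \<mu> f z"
      using \<mu>2 by (simp add: kelvin_def mult.commute)
    with R1(2)[OF z0(2)] show "f z < kelvin \<mu> f z" by linarith
  qed
qed

text \<open>The contact set is compact, having no points near infinity, and nonempty, since it
  contains the sphere. So a furthest contact exists, and \<open>no_contact\<close> places it on the
  sphere. Then all points of the sphere are furthest contacts, and \<open>no_contact\<close> also
  rules out a vanishing radial derivative.\<close>

lemma strict_below:
  assumes l: "0 < l" "below l" and less: "\<gamma> * l\<^sup>2 < f 0"
  shows "l < norm z \<Longrightarrow> f z < kelvin l f z"
    and "norm z = l \<Longrightarrow> z \<bullet> g z < f z"
proof -
  obtain R l' where R: "0 < R" "l < l'"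
    "\<And>\<mu> z. l \<le> \<mu> \<Longrightarrow> \<mu> < l' \<Longrightarrow> R \<le> norm z \<Longrightarrow> f z < kelvin \<mu> f z"
    using strict_at_infinity[OF l(1) less] by blast
  define Z where "Z = {z \<in> {z. l \<le> norm z}. kelvin l f z - f z = 0}"
  have cl: "closed {z::real^'n. l \<le> norm z}" by (intro closed_Collect_le continuous_intros)
  have nz: "z \<noteq> 0" if "l \<le> norm z" for z :: "real^'n" using that l by auto
  have "continuous_on {z. l \<le> norm z} (\<lambda>z. kelvin l f z - f z)"
    using C2_data_isCont(1)[OF C2_data_kelvin[OF C2 l(1)]] f_cont nz
    by (intro continuous_at_imp_continuous_on ballI continuous_diff) (simp_all add: open_Compl)
  then have "closed Z" unfolding Z_def using cl by (rule continuous_closed_preimage_constant)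
  moreover have "Z \<subseteq> cball 0 R"
  proof
    fix z assume "z \<in> Z"
    then have "\<not> R \<le> norm z" using R(3)[of l z] R(2) by (auto simp: Z_def)
    then show "z \<in> cball 0 R" by simp
  qed
  ultimately have "compact Z" using bounded_subset[OF bounded_cball] compact_eq_bounded_closed by blast
  moreover have "l *\<^sub>R axis undefined 1 \<in> Z"
  proof -
    have "norm (l *\<^sub>R axis undefined 1 :: real^'n) = l" using l by simp
    then show ?thesis using kelvin_on_sphere[OF _ l(1)] by (simp add: Z_def)
  qed
  then have "Z \<noteq> {}" by blast
  ultimately obtain z1 where z1: "z1 \<in> Z" "\<And>z. z \<in> Z \<Longrightarrow> norm z \<le> norm z1"
    using continuous_attains_sup[of Z norm] by (auto intro: continuous_intros)
  have out: "f z < kelvin l f z" if "norm z1 < norm z" for z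
  proof -
    have "z \<notin> Z" using z1(2)[of z] that by linarith
    moreover have "l \<le> norm z" using z1(1) that by (simp add: Z_def)
    moreover have "f z \<le> kelvin l f z" using l(2) \<open>l \<le> norm z\<close> by (simp add: below_def)
    ultimately show ?thesis unfolding Z_def by simp
  qed
  have z1l: "norm z1 = l"
  proof (rule ccontr)
    assume "norm z1 \<noteq> l"
    with z1(1) show False by (intro no_contact[OF l, of z1]) (auto simp: Z_def out)
  qed
  then show strict: "l < norm z \<Longrightarrow> f z < kelvin l f z" for z using out by simp
  show "z \<bullet> g z < f z" if z: "norm z = l" for z
  proof -
    have z0: "z \<noteq> 0" using z l by auto
    have "f z \<noteq> z \<bullet> g z"
      using no_contact[OF l, of z] z strict kelvin_on_sphere[OF z l(1)] by auto
    \<comment> \<open>The difference has derivative \<open>2 * (f z - z \<bullet> g z)\<close> along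
      \<open>z\<close>; if negative, it would push \<open>kelvin l f\<close> below \<open>f\<close>
      just outside the sphere.\<close>
    moreover have "\<not> f z < z \<bullet> g z"
    proof
      assume neg: "f z < z \<bullet> g z"
      have w: "((\<lambda>x. kelvin l f x - f x) has_derivative (\<lambda>h. (kelvin_gradient l f g z - g z) \<bullet> h)) (at z)"
        using C2_dataD(1)[OF C2_data_kelvin[OF C2 l(1)], of z] f_deriv[of z] z0
        by (auto simp: inner_diff_left intro: has_derivative_diff)
      have "((\<lambda>t. z + t *\<^sub>R z) has_derivative (\<lambda>h. h *\<^sub>R z)) (at 0)"
        by (auto intro!: derivative_eq_intros)
      from has_derivative_compose[OF this, of "\<lambda>x. kelvin l f x - f x"
          "\<lambda>h. (kelvin_gradient l f g z - g z) \<bullet> h"] w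
      have "((\<lambda>t. kelvin l f (z + t *\<^sub>R z) - f (z + t *\<^sub>R z)) has_real_derivative
          (kelvin_gradient l f g z - g z) \<bullet> z) (at 0)"
        by (simp add: has_field_derivative_def mult_commute_abs)
      moreover have "(kelvin_gradient l f g z - g z) \<bullet> z = 2 * (f z - z \<bullet> g z)"
        using l z by (simp add: kelvin_gradient_on_sphere[OF z l(1)] dot_square_norm)
      ultimately obtain d where d: "d > 0" "\<And>h. 0 < h \<Longrightarrow> h < d \<Longrightarrow>
          kelvin l f (z + h *\<^sub>R z) - f (z + h *\<^sub>R z) < kelvin l f z - f z"
        using DERIV_neg_dec_right[of "\<lambda>t. kelvin l f (z + t *\<^sub>R z) - f (z + t *\<^sub>R z)" "2 * (f z - z \<bullet> g z)" 0] neg by auto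
      have "z + (d / 2) *\<^sub>R z = (1 + d / 2) *\<^sub>R z" by (simp add: scaleR_add_left)
      then have "l \<le> norm (z + (d / 2) *\<^sub>R z)" using z d l by simp
      then have "f (z + (d / 2) *\<^sub>R z) \<le> kelvin l f (z + (d / 2) *\<^sub>R z)" using l by (simp add: below_def)
      with d(2)[of "d / 2"] d(1) kelvin_on_sphere[OF z l(1)] show False by simp
    qed
    ultimately show ?thesis by linarith
  qed
qed

text \<open>The derivative of \<open>f (t *\<^sub>R z) / t\<close> has the sign of \<open>(t
  *\<^sub>R z) \<bullet> g (t *\<^sub>R z) - f (t *\<^sub>R z)\<close>. At
  \<open>t = l\<^sup>2 / (norm z)\<^sup>2\<close> the ratio is \<open>kelvin l f z\<close>, so a
  failure of the comparison at \<open>z\<close> yields a point between \<open>z\<close> and its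
  image under the inversion where the radial inequality fails.\<close>

lemma radial_increase:
  assumes \<tau>: "0 < \<tau>" "\<tau> \<le> 1" and less: "f (\<tau> *\<^sub>R z) / \<tau> < f z"
  obtains t where "\<tau> \<le> t" "t \<le> 1" "f (t *\<^sub>R z) < (t *\<^sub>R z) \<bullet> g (t *\<^sub>R z)"
proof -
  have "\<tau> < 1" using \<tau> less by (cases "\<tau> = 1") auto
  have "((\<lambda>t. f (t *\<^sub>R z) / t) has_real_derivative
      ((g (t *\<^sub>R z) \<bullet> z) * t - f (t *\<^sub>R z)) / (t * t)) (at t)" if "\<tau> \<le> t" for t
  proof -
    have "((\<lambda>t. t *\<^sub>R z) has_derivative (\<lambda>h. h *\<^sub>R z)) (at t)" by (auto intro!: derivative_eq_intros)
    from has_derivative_compose[OF this f_deriv]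
    have "((\<lambda>t. f (t *\<^sub>R z)) has_real_derivative g (t *\<^sub>R z) \<bullet> z) (at t)"
      by (simp add: has_field_derivative_def mult_commute_abs)
    from DERIV_divide[OF this DERIV_ident] show ?thesis using \<tau> that by simp
  qed
  then obtain t where t: "\<tau> < t" "t < 1" "f (1 *\<^sub>R z) / 1 - f (\<tau> *\<^sub>R z) / \<tau> =
      (1 - \<tau>) * (((g (t *\<^sub>R z) \<bullet> z) * t - f (t *\<^sub>R z)) / (t * t))"
    using MVT2[OF \<open>\<tau> < 1\<close>, of "\<lambda>t. f (t *\<^sub>R z) / t"
        "\<lambda>t. ((g (t *\<^sub>R z) \<bullet> z) * t - f (t *\<^sub>R z)) / (t * t)"] by blast
  then have "0 < (1 - \<tau>) * (((g (t *\<^sub>R z) \<bullet> z) * t - f (t *\<^sub>R z)) / (t * t))" using less by simp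
  then have "0 < ((g (t *\<^sub>R z) \<bullet> z) * t - f (t *\<^sub>R z)) / (t * t)"
    using \<open>\<tau> < 1\<close> by (simp only: zero_less_mult_iff) auto
  then have "0 < (g (t *\<^sub>R z) \<bullet> z) * t - f (t *\<^sub>R z)"
    using t \<tau> by (simp add: zero_less_divide_iff)
  then show ?thesis using t by (intro that[of t]) (auto simp: inner_commute mult.commute)
qed

lemma kelvin_radial:
  assumes "z \<noteq> 0" "0 < l"
  shows "kelvin l f z = f ((l\<^sup>2 / (norm z)\<^sup>2) *\<^sub>R z) / (l\<^sup>2 / (norm z)\<^sup>2)"
  by (simp add: kelvin_def inversion_def)

text \<open>Near the origin \<open>f 0 > 0\<close> forces \<open>z \<bullet> g z < f z\<close>, so
  \<open>radial_increase\<close> excludes a failure. Further out, a quadratic upper bound for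
  \<open>f\<close> competes with the lower bound \<open>f y1 * (norm z)\<^sup>2 / l\<^sup>2\<close>
  for the Kelvin transform, which wins for small \<open>l\<close>.\<close>

lemma below_small:
  obtains l0 where "0 < l0" "\<And>l. 0 < l \<Longrightarrow> l \<le> l0 \<Longrightarrow> below l"
proof -
  have "isCont (\<lambda>z. f z - z \<bullet> g z) 0" using f_cont g_cont by (intro continuous_intros)
  then have "((\<lambda>z. f z - z \<bullet> g z) \<longlongrightarrow> f 0 - 0 \<bullet> g 0) (nhds 0)"
    using tendsto_at_iff_tendsto_nhds[of "\<lambda>z. f z - z \<bullet> g z" 0] by (simp only: isCont_def)
  then have "((\<lambda>z. f z - z \<bullet> g z) \<longlongrightarrow> f 0) (nhds 0)" by simp
  from order_tendstoD(1)[OF this pos[of 0]]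
  obtain r1 where r1: "0 < r1" "\<And>z. norm z < r1 \<Longrightarrow> z \<bullet> g z < f z"
    unfolding eventually_nhds_metric by auto
  define r0 where "r0 = min r1 1"
  have r0: "0 < r0" "r0 \<le> 1" "\<And>z. norm z < r0 \<Longrightarrow> z \<bullet> g z < f z" using r1 by (auto simp: r0_def)
  obtain R where R: "0 < R" "\<And>z. R \<le> norm z \<Longrightarrow> f z < (\<gamma> + 1) * (norm z)\<^sup>2"
    using quadratic_growth[of 1] by auto
  have fc: "continuous_on A f" for A using f_cont by (intro continuous_at_imp_continuous_on) auto
  obtain y1 where y1: "\<And>z. norm z \<le> 1 \<Longrightarrow> f y1 \<le> f z"
    using continuous_attains_inf[OF compact_cball _ fc, of 0 1] by force
  obtain y2 where y2: "\<And>z. norm z \<le> R \<Longrightarrow> f z \<le> f y2"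
    using continuous_attains_sup[OF compact_cball _ fc, of 0 R] R(1) by force
  \<comment> \<open>\<open>\<gamma> + 1\<close> serves the points beyond \<open>R\<close>, the
    fraction those between \<open>r0\<close> and \<open>R\<close>.\<close>
  define C where "C = \<gamma> + 1 + f y2 / r0\<^sup>2"
  have C0: "0 < C" using gamma pos[of y2] r0 by (simp add: C_def add_pos_nonneg)
  have C: "f z \<le> C * (norm z)\<^sup>2" if "r0 \<le> norm z" for z
  proof (cases "R \<le> norm z")
    case True
    then have "f z \<le> (\<gamma> + 1) * (norm z)\<^sup>2" using R(2) by (simp add: less_imp_le)
    also have "\<dots> \<le> C * (norm z)\<^sup>2"
      using pos[of y2] r0 by (intro mult_right_mono) (auto simp: C_def)
    finally show ?thesis .
  next
    case False
    have "r0\<^sup>2 \<le> (norm z)\<^sup>2" using that r0 by (intro power_mono) auto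
    then have "f y2 / r0\<^sup>2 * r0\<^sup>2 \<le> f y2 / r0\<^sup>2 * (norm z)\<^sup>2"
      using pos[of y2] by (intro mult_left_mono) auto
    moreover have "f z \<le> f y2" using y2 False by simp
    moreover have "f y2 / r0\<^sup>2 * (norm z)\<^sup>2 \<le> C * (norm z)\<^sup>2"
      using gamma by (intro mult_right_mono) (auto simp: C_def)
    ultimately show ?thesis using r0 by simp
  qed
  \<comment> \<open>The square root gives \<open>C * l\<^sup>2 \<le> f y1\<close>. Since
    \<open>l \<le> r0 \<le> 1\<close>, the inversion sends points beyond \<open>r0\<close> into the
    unit ball, where \<open>f y1\<close> is the minimum.\<close>
  define l0 where "l0 = min r0 (sqrt (f y1 / C))"
  show ?thesis
  proof (rule that[of l0])
    show "0 < l0" using r0 pos C0 by (simp add: l0_def)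
    fix l assume l: "0 < l" "l \<le> l0"
    have "l\<^sup>2 \<le> (sqrt (f y1 / C))\<^sup>2" using l by (intro power_mono) (auto simp: l0_def)
    then have l2: "C * l\<^sup>2 \<le> f y1" using C0 pos[of y1] by (simp add: field_simps)
    show "below l" unfolding below_def
    proof (intro allI impI)
      fix z :: "real^'n" assume z: "l \<le> norm z"
      have z0: "z \<noteq> 0" using z l by auto
      show "f z \<le> kelvin l f z"
      proof (cases "r0 \<le> norm z")
        case True
        have "l * l \<le> 1 * norm z" using l z r0 by (intro mult_mono) (auto simp: l0_def)
        then have "norm (inversion l z) \<le> 1" using z0 by (simp add: norm_inversion power2_eq_square)
        then have "C * l\<^sup>2 \<le> f (inversion l z)" using y1 l2 order_trans by blast
        then have "(norm z)\<^sup>2 / l\<^sup>2 * (C * l\<^sup>2) \<le> kelvin l f z"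
          unfolding kelvin_def by (intro mult_left_mono) auto
        with C[OF True] l show ?thesis by (simp add: mult.commute)
      next
        case False
        show ?thesis
        proof (rule ccontr)
          define \<tau> where "\<tau> = l\<^sup>2 / (norm z)\<^sup>2"
          have "l\<^sup>2 \<le> (norm z)\<^sup>2" using l z by (intro power_mono) auto
          then have \<tau>: "0 < \<tau>" "\<tau> \<le> 1" using z0 l by (simp_all add: \<tau>_def)
          assume "\<not> f z \<le> kelvin l f z"
          then have "f (\<tau> *\<^sub>R z) / \<tau> < f z" by (simp add: kelvin_radial[OF z0 l(1)] \<tau>_def)
          from radial_increase[OF \<tau> this]
          obtain t where t: "\<tau> \<le> t" "t \<le> 1" "f (t *\<^sub>R z) < (t *\<^sub>R z) \<bullet> g (t *\<^sub>R z)" .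
          have "norm (t *\<^sub>R z) \<le> norm z" using t \<tau> by (simp add: mult_left_le_one_le)
          with r0(3)[of "t *\<^sub>R z"] False t show False by simp
        qed
      qed
    qed
  qed
qed

section \<open>Continuation in the radius\<close>

lemma kelvin_tendsto:
  assumes "(\<mu> \<longlongrightarrow> l) G" "(z \<longlongrightarrow> z0) G" "z0 \<noteq> 0" "l \<noteq> 0"
  shows "((\<lambda>k. kelvin (\<mu> k) f (z k)) \<longlongrightarrow> kelvin l f z0) G"
proof -
  have "((\<lambda>k. inversion (\<mu> k) (z k)) \<longlongrightarrow> inversion l z0) G"
    unfolding inversion_def using assms by (auto intro!: tendsto_intros)
  then have "((\<lambda>k. f (inversion (\<mu> k) (z k))) \<longlongrightarrow> f (inversion l z0)) G"
    using f_cont isCont_tendsto_compose by blast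
  then show ?thesis unfolding kelvin_def using assms by (auto intro!: tendsto_intros)
qed

lemma below_limit:
  assumes l: "0 < l" and less: "\<And>\<mu>. 0 < \<mu> \<Longrightarrow> \<mu> < l \<Longrightarrow> below \<mu>"
  shows "below l"
  unfolding below_def
proof (intro allI impI)
  fix z :: "real^'n" assume z: "l \<le> norm z"
  have "((\<lambda>\<mu>. kelvin \<mu> f z) \<longlongrightarrow> kelvin l f z) (at_left l)"
    using z l by (intro kelvin_tendsto) auto
  moreover have "\<forall>\<^sub>F \<mu> in at_left l. f z \<le> kelvin \<mu> f z"
    unfolding eventually_at_left[OF l]
    using less z l by (intro exI[of _ 0]) (auto simp: below_def)
  ultimately show "f z \<le> kelvin l f z" by (intro tendsto_lowerbound) auto
qed

text \<open>Failures at radii decreasing to \<open>l\<close> stay in a fixed ball and accumulate at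
  a point that must lie on the sphere. There the difference vanishes anyway, so the values give no
  contradiction in the limit; the reversed radial inequality from \<open>radial_increase\<close>
  does.\<close>

lemma below_open:
  assumes l: "0 < l" "below l" and less: "\<gamma> * l\<^sup>2 < f 0"
  shows "\<exists>l'>l. \<forall>\<mu>. l < \<mu> \<longrightarrow> \<mu> < l' \<longrightarrow> below \<mu>"
proof (rule ccontr)
  assume "\<not> ?thesis"
  then have bad: "\<exists>\<mu>. l < \<mu> \<and> \<mu> < l' \<and> \<not> below \<mu>" if "l < l'" for l' using that by blast
  obtain R l1 where R: "0 < R" "l < l1"
    "\<And>\<mu> z. l \<le> \<mu> \<Longrightarrow> \<mu> < l1 \<Longrightarrow> R \<le> norm z \<Longrightarrow> f z < kelvin \<mu> f z"
    using strict_at_infinity[OF l(1) less] by blast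
  have "\<exists>\<mu> z. l < \<mu> \<and> \<mu> < l1 \<and> \<mu> < l + 1 / Suc k \<and> \<mu> \<le> norm z \<and> kelvin \<mu> f z < f z" for k :: nat
  proof -
    have "l < min l1 (l + 1 / Suc k)" using R by simp
    from bad[OF this] show ?thesis by (auto simp: below_def not_le)
  qed
  then obtain \<mu> z where \<mu>z: "\<And>k::nat. l < \<mu> k" "\<And>k. \<mu> k < l1" "\<And>k. \<mu> k < l + 1 / Suc k"
    "\<And>k. \<mu> k \<le> norm (z k)" "\<And>k. kelvin (\<mu> k) f (z k) < f (z k)"
    by metis
  have "z k \<in> cball 0 R" for k
    using R(3)[of "\<mu> k" "z k"] \<mu>z(1,2,5)[of k] by (force simp: not_le)
  then obtain z0 r where zr: "strict_mono r" "(z \<circ> r) \<longlonglongrightarrow> z0"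
    using compact_cball[of 0 R] unfolding compact_def by metis
  have "(\<lambda>k. l + 1 / Suc k) \<longlonglongrightarrow> l + 0" by (intro tendsto_add tendsto_const LIMSEQ_Suc[OF lim_1_over_n])
  then have "\<mu> \<longlonglongrightarrow> l"
    using \<mu>z(1,3) by (intro tendsto_sandwich[of "\<lambda>_. l" \<mu> sequentially "\<lambda>k. l + 1 / Suc k"])
      (auto intro: always_eventually less_imp_le)
  then have \<mu>r: "(\<mu> \<circ> r) \<longlonglongrightarrow> l" by (rule LIMSEQ_subseq_LIMSEQ[OF _ zr(1)])
  have z0l: "l \<le> norm z0"
  proof (rule LIMSEQ_le_const[OF tendsto_norm[OF zr(2)]])
    show "\<exists>N. \<forall>n\<ge>N. l \<le> norm ((z \<circ> r) n)"
      using \<mu>z(1,4) by (metis comp_apply less_imp_le order_trans)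
  qed
  then have z0: "z0 \<noteq> 0" using l by auto
  have "(\<lambda>k. kelvin ((\<mu> \<circ> r) k) f ((z \<circ> r) k)) \<longlonglongrightarrow> kelvin l f z0"
    using \<mu>r zr(2) z0 l by (intro kelvin_tendsto) (auto simp: comp_def)
  moreover have "(\<lambda>k. f ((z \<circ> r) k)) \<longlonglongrightarrow> f z0" using zr(2) f_cont isCont_tendsto_compose by blast
  ultimately have "kelvin l f z0 \<le> f z0"
    using \<mu>z(5) by (intro LIMSEQ_le) (auto intro: less_imp_le)
  then have nz0: "norm z0 = l" using strict_below(1)[OF l less, of z0] z0l by fastforce
  \<comment> \<open>The inversion of radius \<open>\<mu> k\<close> sends \<open>z k\<close> to
    \<open>\<tau> k *\<^sub>R z k\<close>. As \<open>z0\<close> lies on the sphere,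
    \<open>\<tau>\<close> tends to 1 along \<open>r\<close>, and the points on the segments in
    between are squeezed to \<open>z0\<close>.\<close>
  define \<tau> where "\<tau> = (\<lambda>k. (\<mu> k)\<^sup>2 / (norm (z k))\<^sup>2)"
  have "\<exists>t. \<tau> k \<le> t \<and> t \<le> 1 \<and> f (t *\<^sub>R z k) < (t *\<^sub>R z k) \<bullet> g (t *\<^sub>R z k)" for k
  proof -
    have \<mu>0: "0 < \<mu> k" using l \<mu>z(1)[of k] by linarith
    then have zk: "z k \<noteq> 0" using \<mu>z(4)[of k] by auto
    have "(\<mu> k)\<^sup>2 \<le> (norm (z k))\<^sup>2" using \<mu>0 \<mu>z(4)[of k] by (intro power_mono) auto
    then have \<tau>: "0 < \<tau> k" "\<tau> k \<le> 1" using \<mu>0 zk by (simp_all add: \<tau>_def)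
    have "f (\<tau> k *\<^sub>R z k) / \<tau> k < f (z k)"
      using \<mu>z(5)[of k] kelvin_radial[OF zk \<mu>0] by (simp add: \<tau>_def)
    from radial_increase[OF \<tau> this] show ?thesis by blast
  qed
  then obtain t where t: "\<And>k. \<tau> k \<le> t k" "\<And>k. t k \<le> 1"
    "\<And>k. f (t k *\<^sub>R z k) < (t k *\<^sub>R z k) \<bullet> g (t k *\<^sub>R z k)" by metis
  have "(\<lambda>k. ((\<mu> \<circ> r) k)\<^sup>2 / (norm ((z \<circ> r) k))\<^sup>2) \<longlonglongrightarrow> l\<^sup>2 / (norm z0)\<^sup>2"
    unfolding comp_apply using \<mu>r[unfolded comp_def] zr(2)[unfolded comp_def] z0
    by (intro tendsto_intros) simp_all
  then have "(\<lambda>k. \<tau> (r k)) \<longlonglongrightarrow> 1" using nz0 l by (simp add: \<tau>_def)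
  then have "(\<lambda>k. t (r k)) \<longlonglongrightarrow> 1"
    using t(1,2) by (intro tendsto_sandwich[of "\<lambda>k. \<tau> (r k)" "\<lambda>k. t (r k)" sequentially "\<lambda>_. 1"]) auto
  then have y: "(\<lambda>k. t (r k) *\<^sub>R (z \<circ> r) k) \<longlonglongrightarrow> z0" using tendsto_scaleR[OF _ zr(2)] by fastforce
  have "f z0 \<le> z0 \<bullet> g z0"
  proof (rule LIMSEQ_le)
    show "(\<lambda>k. f (t (r k) *\<^sub>R (z \<circ> r) k)) \<longlonglongrightarrow> f z0"
      using y f_cont isCont_tendsto_compose by blast
    have "(\<lambda>k. g (t (r k) *\<^sub>R (z \<circ> r) k)) \<longlonglongrightarrow> g z0"
      using y g_cont isCont_tendsto_compose by blast
    with y show "(\<lambda>k. (t (r k) *\<^sub>R (z \<circ> r) k) \<bullet> g (t (r k) *\<^sub>R (z \<circ> r) k)) \<longlonglongrightarrow> z0 \<bullet> g z0"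
      by (rule tendsto_inner)
    show "\<exists>N. \<forall>n\<ge>N. f (t (r n) *\<^sub>R (z \<circ> r) n) \<le> (t (r n) *\<^sub>R (z \<circ> r) n) \<bullet> g (t (r n) *\<^sub>R (z \<circ> r) n)"
      using t(3) by (metis comp_apply less_imp_le)
  qed
  with strict_below(2)[OF l less nz0] show False by linarith
qed

text \<open>A continuity argument: the supremum \<open>s\<close> of the good radii is good by
  \<open>below_limit\<close>, and \<open>below_open\<close> would go beyond it as long as
  \<open>\<gamma> * s\<^sup>2 < f 0\<close>.\<close>

lemma below_critical: "below (sqrt (f 0 / \<gamma>))"
proof -
  define ls where "ls = sqrt (f 0 / \<gamma>)"
  have ls: "0 < ls" "\<gamma> * ls\<^sup>2 = f 0" using pos[of 0] gamma by (auto simp: ls_def less_imp_le)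
  obtain l0 where l0: "0 < l0" "\<And>l. 0 < l \<Longrightarrow> l \<le> l0 \<Longrightarrow> below l" using below_small by blast
  \<comment> \<open>Asking for \<open>below\<close> at all smaller radii makes this set an interval,
    so no radius under its supremum is missed.\<close>
  define S where "S = {l. 0 < l \<and> l \<le> ls \<and> (\<forall>\<mu>. 0 < \<mu> \<longrightarrow> \<mu> \<le> l \<longrightarrow> below \<mu>)}"
  define s where "s = Sup S"
  have inS: "min l0 ls \<in> S" using l0 ls by (auto simp: S_def)
  have bdd: "bdd_above S" by (rule bdd_aboveI[of _ ls]) (simp add: S_def)
  have s: "0 < s" using cSup_upper[OF inS bdd] l0 ls by (simp add: s_def)
  have "s \<le> ls" unfolding s_def
  proof (rule cSup_least)
    show "S \<noteq> {}" using inS by blast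
  qed (simp add: S_def)
  have "below \<mu>" if \<mu>: "0 < \<mu>" "\<mu> < s" for \<mu>
  proof -
    obtain l where "l \<in> S" "\<mu> < l" using \<mu>(2) inS bdd unfolding s_def by (metis empty_iff less_cSup_iff)
    then show ?thesis using \<mu> by (auto simp: S_def)
  qed
  note lt = this
  have bs: "below s" using s lt by (rule below_limit)
  have "s = ls"
  proof (rule ccontr)
    assume "s \<noteq> ls"
    with \<open>s \<le> ls\<close> have sl: "s < ls" by simp
    then have "s\<^sup>2 < ls\<^sup>2" using s by (intro power_strict_mono) auto
    then have "\<gamma> * s\<^sup>2 < f 0" using gamma ls(2) by (metis mult_strict_left_mono)
    from below_open[OF s bs this]
    obtain l' where l': "s < l'" "\<And>\<mu>. s < \<mu> \<Longrightarrow> \<mu> < l' \<Longrightarrow> below \<mu>" by blast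
    define m where "m = (s + min l' ls) / 2"
    have m: "s < m" "m < l'" "m < ls" using l' sl by (auto simp: m_def)
    have "below \<mu>" if "0 < \<mu>" "\<mu> \<le> m" for \<mu>
      using lt[of \<mu>] bs l'(2)[of \<mu>] that m by (cases \<mu> s rule: linorder_cases) auto
    then have "m \<in> S" using m s by (auto simp: S_def)
    then show False using cSup_upper[OF _ bdd] m(1) by (fastforce simp: s_def)
  qed
  with bs show ?thesis by (simp add: ls_def)
qed

text \<open>The inversion turns the first order term of \<open>f\<close> at the origin into a linear
  term at infinity with coefficient \<open>g 0\<close>. An inequality between linear terms in every
  direction is an equality; \<open>\<beta> - g 0\<close> is the direction that reveals it.\<close>

lemma gradient_origin: "g 0 = \<beta>"
proof (rule ccontr)
  assume "g 0 \<noteq> \<beta>"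
  define v where "v = \<beta> - g 0"
  have v: "v \<noteq> 0" "0 < (norm v)\<^sup>2" using \<open>g 0 \<noteq> \<beta>\<close> by (auto simp: v_def)
  define c where "c = f 0 / \<gamma>"
  have c: "0 < c" "\<gamma> * c = f 0" using pos[of 0] gamma by (auto simp: c_def)
  define ls where "ls = sqrt c"
  have ls: "0 < ls" "ls\<^sup>2 = c" using c by (auto simp: ls_def)
  have below: "below ls" using below_critical by (simp add: ls_def c_def)
  have 1: "((\<lambda>t. (f (t *\<^sub>R v) - \<gamma> * (norm (t *\<^sub>R v))\<^sup>2) / t) \<longlongrightarrow> \<beta> \<bullet> v) at_top"
  proof -
    have "filterlim (\<lambda>t. norm v * t) at_top at_top"
      using v by (intro filterlim_tendsto_pos_mult_at_top[OF tendsto_const _ filterlim_ident]) auto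
    moreover have "\<forall>\<^sub>F t in at_top. norm v * t = norm (t *\<^sub>R v)"
      using eventually_ge_at_top[of 0] by eventually_elim simp
    ultimately have "filterlim (\<lambda>t. norm (t *\<^sub>R v)) at_top at_top"
      using filterlim_cong by fast
    then have "filterlim (\<lambda>t. t *\<^sub>R v) at_infinity at_top"
      by (simp add: filterlim_at_infinity_conv_norm_at_top)
    from filterlim_compose[OF expansion this]
    have "((\<lambda>t. (f (t *\<^sub>R v) - \<gamma> * (norm (t *\<^sub>R v))\<^sup>2 - \<beta> \<bullet> (t *\<^sub>R v)) / norm (t *\<^sub>R v) * norm v + \<beta> \<bullet> v)
        \<longlongrightarrow> 0 * norm v + \<beta> \<bullet> v) at_top"
      by (intro tendsto_intros)
    moreover have "\<forall>\<^sub>F t in at_top. (f (t *\<^sub>R v) - \<gamma> * (norm (t *\<^sub>R v))\<^sup>2 - \<beta> \<bullet> (t *\<^sub>R v)) / norm (t *\<^sub>R v) * norm v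
        + \<beta> \<bullet> v = (f (t *\<^sub>R v) - \<gamma> * (norm (t *\<^sub>R v))\<^sup>2) / t"
      using eventually_gt_at_top[of 0] by eventually_elim (use v in \<open>simp add: field_simps\<close>)
    ultimately show ?thesis by (simp add: tendsto_cong)
  qed
  have 2: "((\<lambda>t. (kelvin ls f (t *\<^sub>R v) - \<gamma> * (norm (t *\<^sub>R v))\<^sup>2) / t) \<longlongrightarrow> g 0 \<bullet> v) at_top"
  proof -
    have "((\<lambda>s. s *\<^sub>R v) has_derivative (\<lambda>h. h *\<^sub>R v)) (at 0)" by (auto intro!: derivative_eq_intros)
    from has_derivative_compose[OF this f_deriv]
    have "((\<lambda>s. f (s *\<^sub>R v)) has_real_derivative g 0 \<bullet> v) (at 0)"
      by (simp add: has_field_derivative_def mult_commute_abs)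
    then have "((\<lambda>s. (f (s *\<^sub>R v) - f 0) / s) \<longlongrightarrow> g 0 \<bullet> v) (at 0)"
      by (simp add: DERIV_def)
    \<comment> \<open>The inversion sends \<open>t *\<^sub>R v\<close> to this multiple of
      \<open>v\<close>, so the limit at infinity becomes a difference quotient at 0.\<close>
    moreover have "filterlim (\<lambda>t. c / (norm v)\<^sup>2 * inverse t) (at 0) at_top"
    proof -
      have "((\<lambda>t. c / (norm v)\<^sup>2 * inverse t) \<longlongrightarrow> c / (norm v)\<^sup>2 * 0) at_top"
        by (intro tendsto_mult tendsto_const tendsto_inverse_0_at_top filterlim_ident)
      moreover have "\<forall>\<^sub>F t in at_top. c / (norm v)\<^sup>2 * inverse t \<noteq> 0"
        using eventually_gt_at_top[of 0] by eventually_elim (use v c in simp)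
      ultimately show ?thesis by (simp add: filterlim_at)
    qed
    ultimately have "((\<lambda>t. (f ((c / (norm v)\<^sup>2 * inverse t) *\<^sub>R v) - f 0) / (c / (norm v)\<^sup>2 * inverse t))
        \<longlongrightarrow> g 0 \<bullet> v) at_top"
      by (rule filterlim_compose)
    moreover have "\<forall>\<^sub>F t in at_top. (f ((c / (norm v)\<^sup>2 * inverse t) *\<^sub>R v) - f 0) / (c / (norm v)\<^sup>2 * inverse t)
        = (kelvin ls f (t *\<^sub>R v) - \<gamma> * (norm (t *\<^sub>R v))\<^sup>2) / t"
      using eventually_gt_at_top[of 0]
    proof eventually_elim
      case (elim t)
      have "inversion ls (t *\<^sub>R v) = (c / (norm v)\<^sup>2 * inverse t) *\<^sub>R v"
        unfolding inversion_def ls(2) using elim v by (simp add: field_simps power2_eq_square)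
      moreover have "\<gamma> = f 0 / c" using c by (simp add: field_simps)
      ultimately show ?case
        unfolding kelvin_def ls(2) using elim v c by (simp add: field_simps power2_eq_square)
    qed
    ultimately show ?thesis by (simp add: tendsto_cong)
  qed
  have "\<forall>\<^sub>F t in at_top. (f (t *\<^sub>R v) - \<gamma> * (norm (t *\<^sub>R v))\<^sup>2) / t
      \<le> (kelvin ls f (t *\<^sub>R v) - \<gamma> * (norm (t *\<^sub>R v))\<^sup>2) / t"
    using eventually_gt_at_top[of 0] eventually_ge_at_top[of "ls / norm v"]
  proof eventually_elim
    case (elim t)
    then have "ls \<le> norm (t *\<^sub>R v)" using v by (simp add: field_simps)
    then have "f (t *\<^sub>R v) \<le> kelvin ls f (t *\<^sub>R v)" using below by (simp add: below_def)
    then show ?case using elim by (intro divide_right_mono) auto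
  qed
  then have "\<beta> \<bullet> v \<le> g 0 \<bullet> v" by (intro tendsto_le[OF _ 2 1]) auto
  then have "v \<bullet> v \<le> 0" by (simp add: v_def inner_diff_left)
  moreover have "0 < v \<bullet> v" unfolding inner_gt_zero_iff by (rule v(1))
  ultimately show False by linarith
qed

end

text \<open>Expanding the leading terms at \<open>x + z\<close> produces the new linear coefficient,
  and the constant left over is absorbed by the remainder. Through this,
  \<open>gradient_origin\<close> determines the gradient at every point.\<close>

lemma (in entire_solution) translate:
  "entire_solution U F (\<lambda>y. f (x + y)) (\<lambda>y. g (x + y)) (\<lambda>y. H (x + y)) \<gamma> (\<beta> + (2 * \<gamma>) *\<^sub>R x)"
proof unfold_locales
  have shift: "((\<lambda>y. x + y) has_derivative (\<lambda>h. h)) (at y)" for y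
    by (auto intro!: derivative_eq_intros)
  show "C2_data UNIV (\<lambda>y. f (x + y)) (\<lambda>y. g (x + y)) (\<lambda>y. H (x + y))"
    unfolding C2_data_def
  proof (intro conjI ballI)
    show "((\<lambda>y. f (x + y)) has_derivative (\<lambda>h. g (x + y) \<bullet> h)) (at y)" for y
      using has_derivative_compose[OF shift C2_dataD(1)[OF C2]] by simp
    show "((\<lambda>y. g (x + y)) has_derivative (\<lambda>h. H (x + y) *v h)) (at y)" for y
      using has_derivative_compose[OF shift C2_dataD(2)[OF C2]] by simp
    have "continuous_on UNIV H" using C2 by (simp add: C2_data_def)
    then show "continuous_on UNIV (\<lambda>y. H (x + y))"
      by (rule continuous_on_compose2) (auto intro!: continuous_intros)
  qed
  show "0 < f (x + y)" for y by (rule pos)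
  show "schouten (\<lambda>y. f (x + y)) (\<lambda>y. g (x + y)) (\<lambda>y. H (x + y)) y \<in> U \<and>
      F (schouten (\<lambda>y. f (x + y)) (\<lambda>y. g (x + y)) (\<lambda>y. H (x + y)) y) = 1" for y
    using eq[of "x + y"] by (simp add: schouten_def)
  show "0 < \<gamma>" by (rule gamma)
  define E where "E = (\<lambda>y. f y - \<gamma> * (norm y)\<^sup>2 - \<beta> \<bullet> y)"
  define d where "d = \<gamma> * (norm x)\<^sup>2 + \<beta> \<bullet> x"
  have "filterlim (\<lambda>z. x + z) at_infinity at_infinity"
    by (rule tendsto_add_filterlim_at_infinity[OF tendsto_const filterlim_ident])
  from filterlim_compose[OF expansion this]
  have "((\<lambda>z. E (x + z) / norm (x + z)) \<longlongrightarrow> 0) at_infinity" by (simp add: E_def)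
  then have "((\<lambda>z. E (x + z) / norm z) \<longlongrightarrow> 0) at_infinity"
  \<comment> \<open>The factor 2 comes from \<open>norm (x + z) \<le> 2 * norm z\<close> for
    \<open>norm z \<ge> norm x + 1\<close>.\<close>
  proof (rule tendsto_0_le[where K = 2])
    show "\<forall>\<^sub>F z in at_infinity. norm (E (x + z) / norm z) \<le> norm (E (x + z) / norm (x + z)) * 2"
      unfolding eventually_at_infinity
    proof (intro exI[of _ "norm x + 1"] allI impI)
      fix z :: "real^'n" assume z: "norm x + 1 \<le> norm z"
      have z0: "0 < norm z" using z norm_ge_zero[of x] by linarith
      have 1: "norm (x + z) \<le> 2 * norm z" using norm_triangle_ineq[of x z] z by linarith
      have 2: "0 < norm (x + z)"
      proof -
        have "norm (x + z - x) \<le> norm (x + z) + norm x" by (rule norm_triangle_ineq4)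
        then show ?thesis using z by (simp only: add_diff_cancel_left')
      qed
      have "inverse (norm z) \<le> 2 * inverse (norm (x + z))" using 1 2 z0 by (simp add: field_simps)
      then have "\<bar>E (x + z)\<bar> * inverse (norm z) \<le> \<bar>E (x + z)\<bar> * (2 * inverse (norm (x + z)))"
        by (intro mult_left_mono) auto
      then show "norm (E (x + z) / norm z) \<le> norm (E (x + z) / norm (x + z)) * 2"
        by (simp add: divide_inverse abs_mult mult_ac)
    qed
  qed
  moreover have "((\<lambda>z::real^'n. d / norm z) \<longlongrightarrow> 0) at_infinity"
    by (rule real_tendsto_divide_at_top[OF tendsto_const filterlim_norm_at_top])
  ultimately have "((\<lambda>z. E (x + z) / norm z + d / norm z) \<longlongrightarrow> 0 + 0) at_infinity"
    by (rule tendsto_add)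
  moreover have "E (x + z) / norm z + d / norm z =
      (f (x + z) - \<gamma> * (norm z)\<^sup>2 - (\<beta> + (2 * \<gamma>) *\<^sub>R x) \<bullet> z) / norm z" for z
    by (simp add: E_def d_def add_divide_distrib[symmetric] power2_norm_eq_inner inner_add_left
        inner_add_right inner_commute algebra_simps)
  ultimately show "((\<lambda>z. (f (x + z) - \<gamma> * (norm z)\<^sup>2 - (\<beta> + (2 * \<gamma>) *\<^sub>R x) \<bullet> z) / norm z) \<longlongrightarrow> 0) at_infinity"
    by simp
qed

lemma (in entire_solution) quadratic:
  obtains x0 d where "0 < d" "\<And>x. f x = d + \<gamma> * (norm (x - x0))\<^sup>2"
proof -
  have g: "g x = \<beta> + (2 * \<gamma>) *\<^sub>R x" for x
    using entire_solution.gradient_origin[OF translate[of x]] by simp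
  define q where "q = (\<lambda>x. f x - \<gamma> * (x \<bullet> x) - \<beta> \<bullet> x)"
  have "(q has_derivative (\<lambda>h. 0)) (at x)" for x
    unfolding q_def
    by (rule derivative_eq_intros f_deriv refl)+ (simp add: fun_eq_iff g inner_add_left inner_add_right inner_commute algebra_simps)
  then obtain C where C: "\<And>x. q x = C"
    using has_derivative_zero_constant[of UNIV q] by auto
  \<comment> \<open>Completing the square: \<open>x0\<close> is the critical point of
    \<open>f\<close> and \<open>d\<close> its value there, hence positive.\<close>
  define x0 where "x0 = (- 1 / (2 * \<gamma>)) *\<^sub>R \<beta>"
  define d where "d = C - \<gamma> * (x0 \<bullet> x0)"
  have fx: "f x = d + \<gamma> * (norm (x - x0))\<^sup>2" for x
  proof -
    have "\<beta> = (- 2 * \<gamma>) *\<^sub>R x0" using gamma by (simp add: x0_def)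
    then have "\<beta> \<bullet> x = - 2 * \<gamma> * (x0 \<bullet> x)" by simp
    with C[of x] show ?thesis
      by (simp add: q_def d_def power2_norm_eq_inner inner_diff_left inner_diff_right inner_commute
          algebra_simps)
  qed
  then have "0 < d" using pos[of x0] by simp
  with fx show ?thesis using that by blast
qed

section \<open>Substitution of a power of the solution\<close>

lemma has_derivative_gradient:
  fixes u :: "real^'n \<Rightarrow> real"
  assumes "u differentiable (at x)"
  shows "(u has_derivative (\<lambda>h. gradient u x \<bullet> h)) (at x)"
proof -
  define D where "D = frechet_derivative u (at x)"
  have D: "(u has_derivative D) (at x)" using assms unfolding D_def frechet_derivative_works .
  then have lin: "linear D" by (rule has_derivative_linear)
  have "D h = gradient u x \<bullet> h" for h
  proof -
    have "h = (\<Sum>i\<in>UNIV. h $ i *\<^sub>R axis i 1)"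
      using basis_expansion[of h] by (simp add: scalar_mult_eq_scaleR)
    then have "D h = D (\<Sum>i\<in>UNIV. h $ i *\<^sub>R axis i 1)" by simp
    also have "\<dots> = (\<Sum>i\<in>UNIV. h $ i * D (axis i 1))"
      by (simp add: linear_sum[OF lin] linear_cmul[OF lin])
    finally show ?thesis
      by (simp add: inner_vec_def gradient_def D_def mult.commute)
  qed
  then have "D = (\<lambda>h. gradient u x \<bullet> h)" by (rule ext)
  with D show ?thesis by simp
qed

lemma C2_on_imp_C2_data:
  assumes "C2_on S u"
  shows "C2_data S u (gradient u) (hessian u)"
  using assms
  by (auto simp: C2_on_def C2_data_def hessian_def jacobian_works[symmetric]
      intro: has_derivative_gradient)

definition powr_gradient ::
    "real \<Rightarrow> (real^'n \<Rightarrow> real) \<Rightarrow> (real^'n \<Rightarrow> real^'n) \<Rightarrow> real^'n \<Rightarrow> real^'n"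
  where "powr_gradient p u g x = (p * u x powr (p - 1)) *\<^sub>R g x"

definition powr_hessian ::
    "real \<Rightarrow> (real^'n \<Rightarrow> real) \<Rightarrow> (real^'n \<Rightarrow> real^'n) \<Rightarrow> (real^'n \<Rightarrow> real^'n^'n) \<Rightarrow> real^'n \<Rightarrow> real^'n^'n"
  where "powr_hessian p u g H x = (p * u x powr (p - 1)) *\<^sub>R H x
    + (p * (p - 1) * u x powr (p - 2)) *\<^sub>R outer (g x) (g x)"

lemma has_derivative_powr_const:
  fixes u :: "real^'n \<Rightarrow> real"
  assumes "(u has_derivative (\<lambda>h. g \<bullet> h)) (at x)" "0 < u x"
  shows "((\<lambda>x. u x powr p) has_derivative (\<lambda>h. (p * u x powr (p - 1)) * (g \<bullet> h))) (at x)"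
proof -
  have "((\<lambda>t. t powr p) has_derivative (\<lambda>h. (p * u x powr (p - 1)) * h)) (at (u x))"
    using has_real_derivative_powr[OF assms(2)] by (simp add: has_field_derivative_def)
  from has_derivative_compose[OF assms(1) this] show ?thesis .
qed

lemma C2_data_powr:
  fixes u :: "real^'n \<Rightarrow> real"
  assumes C2: "C2_data S u g H" and S: "open S" and pos: "\<And>x. x \<in> S \<Longrightarrow> 0 < u x"
  shows "C2_data S (\<lambda>x. u x powr p) (powr_gradient p u g) (powr_hessian p u g H)"
  unfolding C2_data_def
proof (intro conjI ballI)
  fix x assume x: "x \<in> S"
  show "((\<lambda>x. u x powr p) has_derivative (\<lambda>h. powr_gradient p u g x \<bullet> h)) (at x)"
    using has_derivative_powr_const[OF C2_dataD(1)[OF C2 x] pos[OF x]]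
    by (simp add: powr_gradient_def)
  have "((\<lambda>x. (p * u x powr (p - 1)) *\<^sub>R g x) has_derivative
      (\<lambda>h. (p * u x powr (p - 1)) *\<^sub>R (H x *v h)
        + (p * ((p - 1) * u x powr (p - 1 - 1) * (g x \<bullet> h))) *\<^sub>R g x)) (at x)"
    by (rule has_derivative_scaleR[OF has_derivative_mult_right[OF
          has_derivative_powr_const[OF C2_dataD(1)[OF C2 x] pos[OF x]]] C2_dataD(2)[OF C2 x]])
  then show "(powr_gradient p u g has_derivative (\<lambda>h. powr_hessian p u g H x *v h)) (at x)"
    unfolding powr_gradient_def[abs_def]
    by (rule has_derivative_eq_rhs) (simp add: fun_eq_iff powr_hessian_def
        matrix_vector_mult_add_rdistrib scaleR_mult_vec outer_mult_vec mult_ac)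
next
  have uc: "continuous_on S u" and gc: "continuous_on S g" and Hc: "continuous_on S H"
    using C2_data_isCont[OF C2 S] by (auto intro!: continuous_at_imp_continuous_on)
  have "\<forall>x\<in>S. u x \<noteq> 0" using pos by force
  then show "continuous_on S (powr_hessian p u g H)"
    unfolding powr_hessian_def[abs_def] outer_def
    by (intro continuous_intros uc gc Hc)
qed

text \<open>For this exponent \<open>f^-2 |dx|^2\<close> is the conformal metric
  \<open>u^(4/(n-2)) |dx|^2\<close>. The three terms carry the powers \<open>2p - 1\<close>,
  \<open>2p - 2\<close> and \<open>2p - 2\<close> of \<open>u\<close>.\<close>

lemma schouten_powr_eq_conformal_hessian:
  fixes u :: "real^'n \<Rightarrow> real"
  assumes dim: "CARD('n) \<ge> 3" and pos: "0 < u x"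
  defines "p \<equiv> - 2 / (real CARD('n) - 2)"
  shows "schouten (\<lambda>x. u x powr p) (powr_gradient p u (gradient u))
    (powr_hessian p u (gradient u) (hessian u)) x = conformal_hessian u x"
proof -
  define n where "n = real CARD('n)"
  define m where "m = n - 2"
  have m: "0 < m" "n = m + 2" using dim by (auto simp: m_def n_def)
  have p: "p = - 2 / m" by (simp add: p_def m_def n_def)
  have 1: "u x powr p * (p * u x powr (p - 1)) = - (2 / m) * u x powr (- ((n + 2) / m))"
  proof -
    have "p + (p - 1) = - ((n + 2) / m)" using m(1) by (simp add: p m(2) field_simps)
    then show ?thesis by (simp add: powr_add[symmetric] mult.left_commute p)
  qed
  have e: "2 * p - 2 = - (2 * n / m)" using m(1) by (simp add: p m(2) field_simps)
  have 2: "u x powr p * (p * (p - 1) * u x powr (p - 2)) = 2 * n / m\<^sup>2 * u x powr (- (2 * n / m))"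
  proof -
    have "p + (p - 2) = - (2 * n / m)" using e by simp
    moreover have "p * (p - 1) = 2 * n / m\<^sup>2"
      using m(1) by (simp add: p m(2) field_simps power2_eq_square)
    ultimately show ?thesis by (simp add: powr_add[symmetric] mult.left_commute)
  qed
  have 3: "(norm (powr_gradient p u (gradient u) x))\<^sup>2 / 2 =
      2 / m\<^sup>2 * u x powr (- (2 * n / m)) * (norm (gradient u x))\<^sup>2"
  proof -
    have "(norm (powr_gradient p u (gradient u) x))\<^sup>2 =
        p\<^sup>2 * (u x powr (p - 1) * u x powr (p - 1)) * (norm (gradient u x))\<^sup>2"
      by (simp add: powr_gradient_def power_mult_distrib power2_eq_square abs_mult)
    also have "u x powr (p - 1) * u x powr (p - 1) = u x powr (- (2 * n / m))"
      unfolding powr_add[symmetric] e[symmetric] by simp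
    finally show ?thesis by (simp add: p power2_eq_square)
  qed
  show ?thesis
    unfolding schouten_def 3 powr_hessian_def conformal_hessian_def Let_def n_def[symmetric]
      m_def[symmetric] scaleR_add_right scaleR_scaleR 1 2 ..
qed

text \<open>Because \<open>(2 - n) p = 2\<close>, regularity says that \<open>f z\<close> is
  \<open>(norm z)\<^sup>2\<close> times \<open>q\<close> at
  \<open>z /\<^sub>R (norm z)\<^sup>2\<close>, where \<open>q\<close> is differentiable at 0. The
  first order expansion of \<open>q\<close> there becomes the expansion of \<open>f\<close>, with
  \<open>\<gamma> = q 0\<close> and \<open>\<beta>\<close> the gradient of \<open>q\<close>.\<close>

lemma regular_at_infinity_expansion:
  fixes u :: "real^'n \<Rightarrow> real"
  assumes dim: "CARD('n) \<ge> 3" and pos: "\<And>x. 0 < u x" and reg: "regular_at_infinity u"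
  defines "p \<equiv> - 2 / (real CARD('n) - 2)"
  obtains \<gamma> \<beta> where "0 < \<gamma>"
    "((\<lambda>z. (u z powr p - \<gamma> * (norm z)\<^sup>2 - \<beta> \<bullet> z) / norm z) \<longlongrightarrow> 0) at_infinity"
proof -
  obtain S v where S: "open S" "0 \<in> S" and v: "C2_on S v" "\<And>x. x \<in> S \<Longrightarrow> 0 < v x"
    and vu: "\<And>x. x \<in> S \<Longrightarrow> x \<noteq> 0 \<Longrightarrow>
      v x = norm x powr (2 - real CARD('n)) * u (x /\<^sub>R (norm x)\<^sup>2)"
    using reg unfolding regular_at_infinity_def by auto
  define q where "q = (\<lambda>x. v x powr p)"
  define \<beta> where "\<beta> = powr_gradient p v (gradient v) 0"
  have "C2_data S q (powr_gradient p v (gradient v)) (powr_hessian p v (gradient v) (hessian v))"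
    unfolding q_def by (rule C2_data_powr[OF C2_on_imp_C2_data[OF v(1)] S(1) v(2)])
  then have "(q has_derivative (\<lambda>h. \<beta> \<bullet> h)) (at 0)"
    unfolding \<beta>_def using C2_dataD(1) S(2) by blast
  then have der: "((\<lambda>y. (q y - q 0 - \<beta> \<bullet> y) / norm y) \<longlongrightarrow> 0) (at 0)"
    by (intro tendsto_norm_zero_cancel[of "\<lambda>y. (q y - q 0 - \<beta> \<bullet> y) / norm y"])
      (simp add: has_derivative_at)
  have inv0: "((\<lambda>z::real^'n. z /\<^sub>R (norm z)\<^sup>2) \<longlongrightarrow> 0) at_infinity"
  proof (rule tendsto_norm_zero_cancel)
    have "((\<lambda>z::real^'n. inverse (norm z)) \<longlongrightarrow> 0) at_infinity"
      by (rule tendsto_inverse_0_at_top[OF filterlim_norm_at_top])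
    moreover have "norm (z /\<^sub>R (norm z)\<^sup>2) = inverse (norm z)" for z :: "real^'n"
      by (cases "z = 0") (simp_all add: power2_eq_square field_simps)
    ultimately show "((\<lambda>z::real^'n. norm (z /\<^sub>R (norm z)\<^sup>2)) \<longlongrightarrow> 0) at_infinity"
      by (simp only:)
  qed
  have nz: "\<forall>\<^sub>F z::real^'n in at_infinity. z \<noteq> 0"
    unfolding eventually_at_infinity by (intro exI[of _ 1]) auto
  have "filterlim (\<lambda>z::real^'n. z /\<^sub>R (norm z)\<^sup>2) (at 0) at_infinity"
    unfolding filterlim_at using inv0 nz by (auto elim: eventually_mono)
  from filterlim_compose[OF der this]
  have lim: "((\<lambda>z. (q (z /\<^sub>R (norm z)\<^sup>2) - q 0 - \<beta> \<bullet> (z /\<^sub>R (norm z)\<^sup>2)) / norm (z /\<^sub>R (norm z)\<^sup>2)) \<longlongrightarrow> 0)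
    at_infinity" .
  have "\<forall>\<^sub>F z in at_infinity. (q (z /\<^sub>R (norm z)\<^sup>2) - q 0 - \<beta> \<bullet> (z /\<^sub>R (norm z)\<^sup>2)) / norm (z /\<^sub>R (norm z)\<^sup>2)
      = (u z powr p - q 0 * (norm z)\<^sup>2 - \<beta> \<bullet> z) / norm z"
    using nz topological_tendstoD[OF inv0 S]
  proof eventually_elim
    case (elim z)
    define y where "y = z /\<^sub>R (norm z)\<^sup>2"
    have ny: "norm y = inverse (norm z)" using elim(1) by (simp add: y_def power2_eq_square field_simps)
    have yz: "y /\<^sub>R (norm y)\<^sup>2 = z" using elim(1) unfolding ny by (simp add: y_def power_inverse)
    have "y \<noteq> 0" "y \<in> S" using elim by (simp_all add: y_def)
    then have "v y = norm y powr (2 - real CARD('n)) * u z" using vu[of y] yz by simp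
    then have "q y = (norm y powr (2 - real CARD('n))) powr p * u z powr p"
      using pos[of z] by (simp add: q_def powr_mult)
    also have "(norm y powr (2 - real CARD('n))) powr p = norm y powr 2"
    proof -
      have "(2 - real CARD('n)) * p = 2" using dim by (simp add: p_def field_simps)
      then show ?thesis by (simp add: powr_powr)
    qed
    also have "norm y powr 2 = (norm y)\<^sup>2" using \<open>y \<noteq> 0\<close> by simp
    finally have qy: "q y = inverse ((norm z)\<^sup>2) * u z powr p" by (simp add: ny power_inverse)
    have "(q y - q 0 - \<beta> \<bullet> y) / norm y = (u z powr p - q 0 * (norm z)\<^sup>2 - \<beta> \<bullet> z) / norm z"
      unfolding qy ny using elim(1) by (simp add: y_def field_simps power2_eq_square)
    then show ?case unfolding y_def .
  qed
  from Lim_transform_eventually[OF lim this]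
  have "((\<lambda>z. (u z powr p - q 0 * (norm z)\<^sup>2 - \<beta> \<bullet> z) / norm z) \<longlongrightarrow> 0) at_infinity" .
  moreover have "0 < q 0" using v(2)[OF S(2)] by (simp add: q_def)
  ultimately show ?thesis using that by blast
qed

theorem theorem1:
  fixes U :: "(real^'n^'n) set"
    and F :: "real^'n^'n \<Rightarrow> real"
    and u :: "real^'n \<Rightarrow> real"
  assumes dim: "CARD('n) \<ge> 3"
    and U_open: "openin (top_of_set sym_matrices) U"
    and U_inv: "\<And>Q :: real^'n^'n. orthogonal_matrix Q \<Longrightarrow>
          (\<lambda>M. matrix_inv Q ** M ** Q) ` U = U"
    and U_convex: "\<And>M N :: real^'n^'n. M \<in> sym_matrices \<Longrightarrow> pos_definite N \<Longrightarrow>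
          convex (U \<inter> {M + t *\<^sub>R N | t. 0 < t})"
    and F_C1: "C1_on_sym U F"
    and F_inv: "\<And>M Q. M \<in> U \<Longrightarrow> orthogonal_matrix Q \<Longrightarrow>
          F (matrix_inv Q ** M ** Q) = F M"
    and F_elliptic: "\<And>M. M \<in> U \<Longrightarrow> pos_definite (sym_gradient U F M)"
    and u_C2: "C2_on UNIV u"
    and u_pos: "\<And>x. u x > 0"
    and u_solves: "\<And>x. conformal_hessian u x \<in> U \<and> F (conformal_hessian u x) = 1"
    and u_regular: "regular_at_infinity u"
  shows "\<exists>(xbar :: real^'n) (a :: real) b. a > 0 \<and> b > 0 \<and>
    (\<forall>x. u x = (a / (1 + b\<^sup>2 * (norm (x - xbar))\<^sup>2)) powr ((real CARD('n) - 2) / 2))"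
proof -
  define p where "p = - 2 / (real CARD('n) - 2)"
  define m where "m = real CARD('n) - 2"
  have m: "0 < m" "p * (- (m / 2)) = 1" using dim by (auto simp: m_def p_def)
  obtain \<gamma> \<beta> where \<gamma>: "0 < \<gamma>"
    and ex: "((\<lambda>z. (u z powr p - \<gamma> * (norm z)\<^sup>2 - \<beta> \<bullet> z) / norm z) \<longlongrightarrow> 0) at_infinity"
    using regular_at_infinity_expansion[OF dim u_pos u_regular] unfolding p_def by blast
  interpret entire_solution U F "\<lambda>x. u x powr p" "powr_gradient p u (gradient u)"
    "powr_hessian p u (gradient u) (hessian u)" \<gamma> \<beta>
  proof
    show "C2_data UNIV (\<lambda>x. u x powr p) (powr_gradient p u (gradient u))
        (powr_hessian p u (gradient u) (hessian u))"
      using u_pos by (intro C2_data_powr C2_on_imp_C2_data u_C2) auto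
    show "0 < u x powr p" for x using u_pos[of x] by simp
    show "schouten (\<lambda>x. u x powr p) (powr_gradient p u (gradient u))
          (powr_hessian p u (gradient u) (hessian u)) x \<in> U \<and>
        F (schouten (\<lambda>x. u x powr p) (powr_gradient p u (gradient u))
          (powr_hessian p u (gradient u) (hessian u)) x) = 1" for x
      unfolding p_def schouten_powr_eq_conformal_hessian[OF dim u_pos] by (rule u_solves)
  qed (fact U_open U_inv U_convex F_C1 F_inv F_elliptic \<gamma> ex)+
  obtain x0 d where d: "0 < d" and q: "\<And>x. u x powr p = d + \<gamma> * (norm (x - x0))\<^sup>2"
    using quadratic by blast
  show ?thesis
  proof (intro exI conjI allI)
    \<comment> \<open>The witnesses come from writing the polynomial as
      \<open>d * (1 + (\<gamma> / d) * (norm (x - x0))\<^sup>2)\<close>; the exponent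
      \<open>- (n - 2) / 2\<close> inverts \<open>p\<close>.\<close>
    show "0 < 1 / d" "0 < sqrt (\<gamma> / d)" using d \<gamma> by auto
    fix x
    have "u x = (u x powr p) powr (- (m / 2))"
      using u_pos[of x] by (simp only: powr_powr m) simp
    also have "\<dots> = (inverse (u x powr p)) powr (m / 2)"
      by (simp add: powr_minus inverse_powr)
    also have "inverse (u x powr p) = (1 / d) / (1 + (sqrt (\<gamma> / d))\<^sup>2 * (norm (x - x0))\<^sup>2)"
      using d \<gamma> by (simp add: q field_simps)
    finally show "u x = ((1 / d) / (1 + (sqrt (\<gamma> / d))\<^sup>2 * (norm (x - x0))\<^sup>2)) powr
        ((real CARD('n) - 2) / 2)"
      by (simp only: m_def)
  qed
qed

end
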